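(* Let $G$ be a Lie groupoid, let $x_0\in G^{(0)}$, and let $\psi:U\times V\to G$, $\varphi:U\to G^{(0)}$ be adapted charts at $x_0$, with $\sigma:U\times V\to U$ the local expression of the source map, as in the context. (i) For $u,u_1\in U$ and $v,w\in V$ one has $(\psi(u,v),\psi(u_1,w))\in G^{(2)}$ if and only if $u_1=\sigma(u,v)$. In this case the product is given by $$\psi(u,v)\,\psi(\sigma(u,v),w)=\psi(u,p(u,v,w)),$$ where $p:U\times V\times V\to V$ is a differentiable map which has an expansion of the form $$p(u,v,w)=v+w+B(u,v,w)+O_3(u,v,w),$$ with $B$ bilinear in $(v,w)$ and $O_3(u,v,w)$ of the order of $\|(v,w)\|^3$. (ii) Let $(u,v)\in U\times V$ be such that $\psi(u,v)^{-1}\in\psi(U\times V)$. Then $\psi(u,v)^{-1}=\psi(\sigma(u,v),w)$, where $w$ satisfies $p(u,v,w)=0$. Moreover one has the expansion $$w=-v+B(u,v,v)+O_3(u,v),$$ where $B$ is the bilinear term in (i) and $O_3(u,v)$ is of degree of homogeneity at least $3$ in $v$.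
   Context: A groupoid $G$ has a partially defined product on $G^{(2)}\subset G\times G$ and an inversion $g\mapsto g^{-1}$; $r(g)=gg^{-1}$, $s(g)=g^{-1}g$, the unit space is $G^{(0)}=r(G)=s(G)\subset G$, and $(g_1,g_2)\in G^{(2)}$ (that is, $g_1g_2$ is defined) if and only if $s(g_1)=r(g_2)$. A Lie groupoid is a groupoid $G$ with a differentiable manifold structure such that $G^{(0)}$ is a submanifold of $G$, $r,s:G\to G^{(0)}$ are submersions, and the multiplication $G^{(2)}\to G$ is differentiable (inversion is then a diffeomorphism). Let $n=\dim G^{(0)}$ and $m=\dim G-\dim G^{(0)}$. Adapted charts at $x_0\in G^{(0)}$: $U$ is an open neighbourhood of $0$ in $\mathbb{R}^n$, $V$ an open neighbourhood of $0$ in $\mathbb{R}^m$, and $\psi:U\times V\to G$, $\varphi:U\to G^{(0)}$ are charts (diffeomorphisms onto open subsets of $G$ and $G^{(0)}$ respectively) such that (1) $\psi(0,0)=x_0$; (2) $r(\psi(u,v))=\varphi(u)$ for all $(u,v)$; (3) $\psi(U\times\{0\})=\psi(U\times V)\cap G^{(0)}$. Consequently $\varphi(u)=\psi(u,0)$. Reducing $V$ if necessary, it is assumed that $s(\psi(u,v))\in\varphi(U)$ for all $(u,v)\in U\times V$. Then $\sigma=\varphi^{-1}\circ s\circ\psi:U\times V\to U$ is a submersion with $s(\psi(u,v))=\varphi(\sigma(u,v))$ and $\sigma(u,0)=u$.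
   Formalization: The map p is defined not on all of U×V×V (for G=R, V=(-1,1), the product 0.9+0.9 leaves the chart) but on the set of (u,v,w) whose product lies in ψ(U×V), which is shown to be open and to contain U×{0}×{0}. *)

theory Defs
  imports "HOL-Analysis.Analysis" "HOL-Library.Landau_Symbols"
begin

section \<open>Model spaces and smooth maps between them\<close>

text \<open>
  Up to isometry, a finite-dimensional real inner product space of dimension \<open>n\<close> is
  \<open>R^n\<close>. The class \<^class>\<open>euclidean_space\<close> only has members of positive dimension; dimension
  \<open>0\<close> is needed here for Lie groups (\<open>n = 0\<close>) and for etale groupoids (\<open>m = 0\<close>).
\<close>

class finite_dim_inner = real_inner +
  assumes finite_dim: "\<exists>B. finite B \<and> (\<forall>x. \<exists>a. x = (\<Sum>b\<in>B. a b *\<^sub>R b))"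

subclass (in euclidean_space) finite_dim_inner
proof
  show "\<exists>B. finite B \<and> (\<forall>x. \<exists>a. x = (\<Sum>b\<in>B. a b *\<^sub>R b))"
    by (rule exI[of _ Basis])
      (metis finite_Basis euclidean_representation)
qed

text \<open>
  \<open>Ck_on k f S\<close>: all directional derivatives of \<open>f\<close> of order at most \<open>k\<close> exist and are
  continuous on \<open>S\<close>. Only meaningful, and only used, for \<open>S\<close> open in a finite-dimensional space.
\<close>

primrec Ck_on :: "nat \<Rightarrow> ('a::real_normed_vector \<Rightarrow> 'b::real_normed_vector) \<Rightarrow> 'a set \<Rightarrow> bool" where
  "Ck_on 0 f S \<longleftrightarrow> continuous_on S f"
| "Ck_on (Suc k) f S \<longleftrightarrow>
     (\<forall>x\<in>S. f differentiable (at x)) \<and> (\<forall>h. Ck_on k (\<lambda>x. frechet_derivative f (at x) h) S)"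

definition smooth_on :: "'a::real_normed_vector set \<Rightarrow> ('a \<Rightarrow> 'b::real_normed_vector) \<Rightarrow> bool" where
  "smooth_on S f \<longleftrightarrow> (\<forall>k. Ck_on k f S)"


section \<open>Manifolds, submanifolds, submersions\<close>

text \<open>A chart \<open>(D, c)\<close> is the map \<open>c\<close> restricted to its domain \<open>D\<close>.\<close>

type_synonym ('a, 'e) chart = "'a set \<times> ('a \<Rightarrow> 'e)"

text \<open>
  Neither the Hausdorff property nor second countability is imposed, so that Lie groupoids with
  a non-Hausdorff space of arrows are covered as well.
\<close>

definition smooth_manifold :: "'a topology \<Rightarrow> ('a, 'e::real_normed_vector) chart set \<Rightarrow> bool" where
  "smooth_manifold X A \<longleftrightarrow>
     (\<forall>(D, c)\<in>A. openin X D \<and> open (c ` D) \<and>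
        homeomorphic_map (subtopology X D) (top_of_set (c ` D)) c) \<and>
     (\<Union>(D, c)\<in>A. D) = topspace X \<and>
     (\<forall>(D, c)\<in>A. \<forall>(D', c')\<in>A. smooth_on (c ` (D \<inter> D')) (c' \<circ> inv_into D c))"

definition flat_atlas :: "('e, 'e::real_normed_vector) chart set" where
  "flat_atlas = {(UNIV, \<lambda>x. x)}"

definition product_atlas ::
  "('a, 'e) chart set \<Rightarrow> ('b, 'f) chart set \<Rightarrow> ('a \<times> 'b, 'e \<times> 'f) chart set" where
  "product_atlas A B = {(D \<times> D', map_prod c c') | D c D' c'. (D, c) \<in> A \<and> (D', c') \<in> B}"

text \<open>
  Smoothness of \<open>f\<close> on an arbitrary subset \<open>S\<close> of a manifold: near each point of \<open>S\<close>, the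
  expression of \<open>f\<close> in charts is the restriction of a smooth map \<open>F\<close> defined on an open set. For
  \<open>S\<close> open, and for \<open>S\<close> an embedded submanifold, this is smoothness in the usual sense.
\<close>

definition smooth_map ::
  "('a, 'e::real_normed_vector) chart set \<Rightarrow> 'a set \<Rightarrow>
   ('b, 'f::real_normed_vector) chart set \<Rightarrow> ('a \<Rightarrow> 'b) \<Rightarrow> bool" where
  "smooth_map A S B f \<longleftrightarrow>
     (\<forall>x\<in>S. \<exists>(D, c)\<in>A. \<exists>(D', c')\<in>B. \<exists>W F.
        x \<in> D \<and> f x \<in> D' \<and> open W \<and> c x \<in> W \<and> smooth_on W F \<and>
        (\<forall>y\<in>S \<inter> D. c y \<in> W \<longrightarrow> f y \<in> D' \<and> c' (f y) = F (c y)))"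

definition diffeomorphism ::
  "('a, 'e::real_normed_vector) chart set \<Rightarrow> 'a set \<Rightarrow>
   ('b, 'f::real_normed_vector) chart set \<Rightarrow> 'b set \<Rightarrow> ('a \<Rightarrow> 'b) \<Rightarrow> bool" where
  "diffeomorphism A S B T f \<longleftrightarrow>
     bij_betw f S T \<and> smooth_map A S B f \<and> smooth_map B T A (inv_into S f)"

text \<open>Charts as maps into the manifold.\<close>

definition parametrization ::
  "'a topology \<Rightarrow> ('a, 'e::real_normed_vector) chart set \<Rightarrow> 'e set \<Rightarrow> ('e \<Rightarrow> 'a) \<Rightarrow> bool" where
  "parametrization X A W f \<longleftrightarrow>
     open W \<and> openin X (f ` W) \<and> diffeomorphism flat_atlas W A (f ` W) f"

text \<open>
  \<open>slice_charts X A N\<close> collects the restrictions to \<open>N\<close> of those charts of the maximal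
  atlas, with values in \<open>'u \<times> 'v\<close>, in which \<open>N\<close> becomes the slice \<open>{(u, v). v = 0}\<close>; these
  restrictions take values in \<open>'u\<close>. They form the atlas of the submanifold \<open>N\<close>, whose dimension
  is therefore that of \<open>'u\<close> and whose codimension is that of \<open>'v\<close>.
\<close>

definition slice_charts ::
  "'a topology \<Rightarrow> ('a, 'u::real_normed_vector \<times> 'v::real_normed_vector) chart set \<Rightarrow> 'a set \<Rightarrow>
   ('a, 'u) chart set" where
  "slice_charts X A N = {(D \<inter> N, fst \<circ> c) | D (c :: 'a \<Rightarrow> 'u \<times> 'v).
     openin X D \<and> open (c ` D) \<and> diffeomorphism A D flat_atlas (c ` D) c \<and>
     c ` (D \<inter> N) = c ` D \<inter> (UNIV \<times> {0})}"

definition submanifold ::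
  "'a topology \<Rightarrow> ('a, 'u::real_normed_vector \<times> 'v::real_normed_vector) chart set \<Rightarrow> 'a set \<Rightarrow>
   bool" where
  "submanifold X A N \<longleftrightarrow> N \<subseteq> topspace X \<and> N \<subseteq> (\<Union>(D, c)\<in>slice_charts X A N. D)"

definition submersion ::
  "('a, 'e::real_normed_vector) chart set \<Rightarrow> 'a set \<Rightarrow>
   ('b, 'f::real_normed_vector) chart set \<Rightarrow> ('a \<Rightarrow> 'b) \<Rightarrow> bool" where
  "submersion A S B f \<longleftrightarrow> smooth_map A S B f \<and>
     (\<forall>x\<in>S. \<forall>(D, c)\<in>A. \<forall>(D', c')\<in>B. x \<in> D \<longrightarrow> f x \<in> D' \<longrightarrow>
        surj (frechet_derivative (c' \<circ> f \<circ> inv_into D c) (at (c x))))"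


section \<open>Lie groupoids\<close>

record 'g groupoid_data =
  arrows :: "'g set"
  composable :: "('g \<times> 'g) set"
  prod_of :: "'g \<Rightarrow> 'g \<Rightarrow> 'g"
  inv_of :: "'g \<Rightarrow> 'g"

definition rng :: "'g groupoid_data \<Rightarrow> 'g \<Rightarrow> 'g" where
  "rng G g = prod_of G g (inv_of G g)"

definition src :: "'g groupoid_data \<Rightarrow> 'g \<Rightarrow> 'g" where
  "src G g = prod_of G (inv_of G g) g"

definition units :: "'g groupoid_data \<Rightarrow> 'g set" where
  "units G = rng G ` arrows G"

text \<open>
  These are the usual algebraic axioms (Hahn, Renault). That \<open>(g, h)\<close> is composable if and only
  if \<open>s(g) = r(h)\<close>, and that the units are also the image of \<open>s\<close>, follows from them.
\<close>

locale groupoid =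
  fixes G :: "'g groupoid_data" (structure)
  assumes composable_subset: "composable G \<subseteq> arrows G \<times> arrows G"
    and prod_closed: "(g, h) \<in> composable G \<Longrightarrow> prod_of G g h \<in> arrows G"
    and inv_closed: "g \<in> arrows G \<Longrightarrow> inv_of G g \<in> arrows G"
    and inv_inv: "g \<in> arrows G \<Longrightarrow> inv_of G (inv_of G g) = g"
    and assoc: "(g, h) \<in> composable G \<Longrightarrow> (h, k) \<in> composable G \<Longrightarrow>
        (prod_of G g h, k) \<in> composable G \<and> (g, prod_of G h k) \<in> composable G \<and>
        prod_of G (prod_of G g h) k = prod_of G g (prod_of G h k)"
    and inv_composable: "g \<in> arrows G \<Longrightarrow> (inv_of G g, g) \<in> composable G"
    and inv_cancel_left: "(g, h) \<in> composable G \<Longrightarrow>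
        prod_of G (inv_of G g) (prod_of G g h) = h"
    and inv_cancel_right: "(g, h) \<in> composable G \<Longrightarrow>
        prod_of G (prod_of G g h) (inv_of G h) = g"
begin

lemma composable_inv: "g \<in> arrows G \<Longrightarrow> (g, inv_of G g) \<in> composable G"
  using inv_composable[of "inv_of G g"] inv_closed inv_inv by simp

lemma rng_inv: "g \<in> arrows G \<Longrightarrow> rng G (inv_of G g) = src G g"
  by (simp add: rng_def src_def inv_inv)

lemma src_inv: "g \<in> arrows G \<Longrightarrow> src G (inv_of G g) = rng G g"
  by (simp add: rng_def src_def inv_inv)

lemma units_eq_src: "units G = src G ` arrows G"
  unfolding units_def
  by (auto simp: image_iff) (metis inv_closed rng_inv src_inv)+

lemma composable_iff:
  assumes g: "g \<in> arrows G" and h: "h \<in> arrows G"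
  shows "(g, h) \<in> composable G \<longleftrightarrow> src G g = rng G h"
proof
  assume gh: "(g, h) \<in> composable G"
  have "prod_of G (inv_of G g) (prod_of G (prod_of G g h) (inv_of G h)) = src G g"
    by (simp add: inv_cancel_right[OF gh] src_def)
  moreover have "prod_of G (prod_of G g h) (inv_of G h) = prod_of G g (rng G h)"
    and "(g, rng G h) \<in> composable G"
    using assoc[OF gh composable_inv[OF h]] by (auto simp: rng_def)
  ultimately show "src G g = rng G h"
    using inv_cancel_left by metis
next
  assume eq: "src G g = rng G h"
  have a: "(g, src G g) \<in> composable G" "prod_of G g (src G g) = g"
    using assoc[OF composable_inv[OF g] inv_composable[OF g]]
      inv_cancel_left[OF inv_composable[OF g]] inv_inv[OF g]
    by (auto simp: src_def)
  have b: "(rng G h, h) \<in> composable G"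
    using assoc[OF composable_inv[OF h] inv_composable[OF h]] by (auto simp: rng_def)
  show "(g, h) \<in> composable G"
    using assoc[OF a(1) b[folded eq]] a(2) by simp
qed

end

text \<open>
  The arrows are modelled on \<open>'u \<times> 'v\<close> and the units on \<open>'u\<close>, so \<open>n\<close> is the dimension of \<open>'u\<close>
  and \<open>m\<close> is that of \<open>'v\<close>.
\<close>

definition lie_groupoid ::
  "'g groupoid_data \<Rightarrow> 'g topology \<Rightarrow>
   ('g, 'u::finite_dim_inner \<times> 'v::finite_dim_inner) chart set \<Rightarrow> bool" where
  "lie_groupoid G X A \<longleftrightarrow>
     groupoid G \<and> topspace X = arrows G \<and> smooth_manifold X A \<and>
     submanifold X A (units G) \<and>
     submersion A (arrows G) (slice_charts X A (units G)) (rng G) \<and>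
     submersion A (arrows G) (slice_charts X A (units G)) (src G) \<and>
     smooth_map (product_atlas A A) (composable G) A (\<lambda>(g, h). prod_of G g h)"

definition adapted_charts ::
  "'g groupoid_data \<Rightarrow> 'g topology \<Rightarrow>
   ('g, 'u::finite_dim_inner \<times> 'v::finite_dim_inner) chart set \<Rightarrow> 'g \<Rightarrow>
   'u set \<Rightarrow> 'v set \<Rightarrow> ('u \<times> 'v \<Rightarrow> 'g) \<Rightarrow> ('u \<Rightarrow> 'g) \<Rightarrow> bool" where
  "adapted_charts G X A x\<^sub>0 U V \<psi> \<phi> \<longleftrightarrow>
     open U \<and> 0 \<in> U \<and> open V \<and> 0 \<in> V \<and>
     parametrization X A (U \<times> V) \<psi> \<and>
     parametrization (subtopology X (units G)) (slice_charts X A (units G)) U \<phi> \<and>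
     \<psi> (0, 0) = x\<^sub>0 \<and>
     (\<forall>u\<in>U. \<forall>v\<in>V. rng G (\<psi> (u, v)) = \<phi> u) \<and>
     \<psi> ` (U \<times> {0}) = \<psi> ` (U \<times> V) \<inter> units G"

text \<open>
  The product of two arrows in the range of \<open>\<psi>\<close> need not lie in the range of \<open>\<psi>\<close>; the local
  expression of the product is defined on the following set only.
\<close>

definition product_domain ::
  "'g groupoid_data \<Rightarrow> 'u set \<Rightarrow> 'v set \<Rightarrow> ('u \<times> 'v \<Rightarrow> 'g) \<Rightarrow> ('u \<times> 'v \<Rightarrow> 'u) \<Rightarrow>
   ('u \<times> 'v \<times> 'v) set" where
  "product_domain G U V \<psi> \<sigma> = {(u, v, w). u \<in> U \<and> v \<in> V \<and> w \<in> V \<and>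
     prod_of G (\<psi> (u, v)) (\<psi> (\<sigma> (u, v), w)) \<in> \<psi> ` (U \<times> V)}"

definition inverse_domain ::
  "'g groupoid_data \<Rightarrow> 'u set \<Rightarrow> 'v set \<Rightarrow> ('u \<times> 'v \<Rightarrow> 'g) \<Rightarrow> ('u \<times> 'v) set" where
  "inverse_domain G U V \<psi> = {(u, v). u \<in> U \<and> v \<in> V \<and> inv_of G (\<psi> (u, v)) \<in> \<psi> ` (U \<times> V)}"

end

theory Submission
  imports Defs
begin

text \<open>
  In the chart \<open>\<psi>\<close> the product becomes a smooth map \<open>p\<close> with \<open>p(u, v, 0) = v\<close> and
  \<open>p(u, 0, w) = w\<close>, because \<open>\<psi>(u, 0)\<close> is a unit. Hence \<open>p(u, v, w) - v - w\<close> is a second difference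
  of \<open>p\<close> and agrees with the mixed derivative \<open>B = \<partial>\<^sub>v \<partial>\<^sub>w p (u, 0, 0)\<close> up to third order,
  locally uniformly in \<open>u\<close>. The map \<open>w \<mapsto> w - p(u, v, w)\<close> is a contraction near \<open>0\<close>, so
  \<open>p(u, v, w) = 0\<close> has a small solution \<open>w = - v + O(\<bar>v\<bar>\<^sup>2)\<close>. By uniqueness of inverses it is the
  coordinate of \<open>\<psi>(u, v)\<^sup>-\<^sup>1\<close>, so no continuity of the inversion has to be known beforehand, and
  substituting it into the expansion of \<open>p\<close> yields the expansion of \<open>w\<close>.
\<close>

section \<open>Finite-dimensional inner product spaces\<close>

text \<open>A product has the range of its first factor, so in the chart only its \<open>'v\<close>
  coordinate is unknown, and the shift of the second factor to the base point
  \<open>\<sigma> (u, v)\<close> is absorbed into \<open>p\<close>. What remains is a map with two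
  unit laws and a parameter \<open>u\<close>. The obstacle is the form of the smoothness hypothesis:
  it concerns the set of composable pairs, which need not be open among all pairs, and offers one
  unspecified chart at each point. The triples \<open>(u, v, w)\<close> parametrize composable pairs
  by an open set, on which ordinary derivatives make sense. The derivatives are continuous for each
  fixed choice of directions only; bounds uniform in the directions come from linearity and an
  orthonormal basis. The sign of \<open>B(u, v, v)\<close> in the inverse arises as follows:
  \<open>w + v\<close> is of second order, so
  \<open>B(u, v, w) = - B(u, v, v) + B(u, v, w + v)\<close> with a last term of third order, and
  solving \<open>0 = v + w + B(u, v, w) + ...\<close> for \<open>w\<close> reverses the
  sign.\<close>

instance prod :: (finite_dim_inner, finite_dim_inner) finite_dim_inner
proof
  obtain B :: "'a set" where B: "finite B" "\<And>x. \<exists>a. x = (\<Sum>b\<in>B. a b *\<^sub>R b)"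
    using finite_dim by blast
  obtain C :: "'b set" where C: "finite C" "\<And>x. \<exists>a. x = (\<Sum>b\<in>C. a b *\<^sub>R b)"
    using finite_dim by blast
  define D where "D = (\<lambda>b. (b, 0::'b)) ` B \<union> (\<lambda>c. (0::'a, c)) ` C"
  have span: "x \<in> span D" for x
  proof -
    obtain a c where ac: "fst x = (\<Sum>b\<in>B. a b *\<^sub>R b)" "snd x = (\<Sum>b\<in>C. c b *\<^sub>R b)"
      using B(2) C(2) by blast
    have "x = (\<Sum>b\<in>B. a b *\<^sub>R (b, 0)) + (\<Sum>b\<in>C. c b *\<^sub>R (0, b))"
      by (rule prod_eqI) (simp_all add: ac fst_sum snd_sum)
    also have "\<dots> \<in> span D"
      by (intro span_add span_sum span_scale span_base) (auto simp: D_def)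
    finally show ?thesis .
  qed
  have fD: "finite D" by (simp add: D_def B C)
  show "\<exists>B. finite B \<and> (\<forall>x::'a \<times> 'b. \<exists>a. x = (\<Sum>b\<in>B. a b *\<^sub>R b))"
    using fD span unfolding span_finite[OF fD] by (intro exI[of _ D]) auto
qed

lemma finite_dim_orthonormal:
  obtains B :: "'a::finite_dim_inner set" where "finite B" "\<And>b. b \<in> B \<Longrightarrow> norm b = 1"
    "\<And>x. x = (\<Sum>b\<in>B. (x \<bullet> b) *\<^sub>R b)"
proof -
  obtain B :: "'a set" where B: "finite B" "\<And>x. \<exists>a. x = (\<Sum>b\<in>B. a b *\<^sub>R b)"
    using finite_dim by blast
  have spB: "x \<in> span B" for x
    using B(2)[of x] by (auto intro!: span_sum span_scale intro: span_base)
  obtain C where C: "finite C" "span C = span B" "pairwise orthogonal C"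
    using basis_orthogonal[OF B(1)] by blast
  \<comment> \<open>The orthogonal spanning set \<open>C\<close> may contain \<open>0\<close>, which
    has to go before normalizing.\<close>
  define E where "E = (\<lambda>c. c /\<^sub>R norm c) ` (C - {0})"
  have fE: "finite E" using C(1) by (simp add: E_def)
  have nE: "norm b = 1" if "b \<in> E" for b
    using that by (auto simp: E_def simp del: left_inverse) (metis left_inverse norm_eq_zero)
  have orth: "b \<bullet> b' = 0" if b: "b \<in> E" "b' \<in> E" "b \<noteq> b'" for b b'
    using b C(3) by (fastforce simp: E_def pairwise_def orthogonal_def)
  have spE: "x \<in> span E" for x
  proof -
    have "c \<in> span E" if "c \<in> C" for c
    proof (cases "c = 0")
      case False
      then have "c = norm c *\<^sub>R (c /\<^sub>R norm c)" by simp
      also have "\<dots> \<in> span E" using that False by (intro span_scale span_base) (auto simp: E_def)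
      finally show ?thesis .
    qed (simp add: span_zero)
    then have "span C \<subseteq> span E" by (simp add: span_minimal subsetI)
    then show ?thesis using spB C(2) by auto
  qed
  have "x = (\<Sum>b\<in>E. (x \<bullet> b) *\<^sub>R b)" for x
  proof -
    obtain a where a: "x = (\<Sum>b\<in>E. a b *\<^sub>R b)"
      using spE[of x] unfolding span_finite[OF fE] by auto
    have "x \<bullet> b = a b" if "b \<in> E" for b
    proof -
      have "x \<bullet> b = (\<Sum>b'\<in>E. a b' * (b' \<bullet> b))"
        unfolding a by (simp add: inner_sum_left)
      also have "\<dots> = (\<Sum>b'\<in>E. if b' = b then a b' else 0)"
        by (intro sum.cong refl) (use that nE orth in \<open>auto simp: norm_eq_1\<close>)
      also have "\<dots> = a b" using that fE by simp
      finally show ?thesis .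
    qed
    then show ?thesis using a by simp
  qed
  with fE nE show ?thesis using that by blast
qed

text \<open>Coordinates of a Cauchy sequence in an orthonormal basis are Cauchy in the reals.
  Completeness is what the fixed point theorem for the inverse requires.\<close>

lemma complete_UNIV_finite_dim: "complete (UNIV :: 'a::finite_dim_inner set)"
  unfolding complete_def
proof (intro allI impI)
  fix f :: "nat \<Rightarrow> 'a" assume "(\<forall>n. f n \<in> UNIV) \<and> Cauchy f"
  then have f: "Cauchy f" by simp
  obtain B :: "'a set" where B: "finite B" "\<And>b. b \<in> B \<Longrightarrow> norm b = 1"
    "\<And>x. x = (\<Sum>b\<in>B. (x \<bullet> b) *\<^sub>R b)"
    using finite_dim_orthonormal by blast
  have "convergent (\<lambda>n. f n \<bullet> b)" for b
    using bounded_linear.Cauchy[OF bounded_linear_inner_left f] by (simp add: Cauchy_convergent_iff)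
  then obtain L where L: "\<And>b. (\<lambda>n. f n \<bullet> b) \<longlonglongrightarrow> L b"
    unfolding convergent_def by metis
  have "(\<lambda>n. \<Sum>b\<in>B. (f n \<bullet> b) *\<^sub>R b) \<longlonglongrightarrow> (\<Sum>b\<in>B. L b *\<^sub>R b)"
    by (intro tendsto_intros L)
  then show "\<exists>l\<in>UNIV. f \<longlonglongrightarrow> l" using B(3)[symmetric] by auto
qed

text \<open>Exchanges "for each direction \<open>h\<close> a bound" for one bound for all
  \<open>h\<close>, by expanding \<open>h\<close> in a finite orthonormal basis. The index
  \<open>i\<close> with weight \<open>\<omega> i\<close> carries directions treated earlier, so that
  the lemma can be iterated on multilinear expressions.\<close>

lemma eventually_finite_dim_bound:
  fixes F :: "'h::finite_dim_inner \<Rightarrow> 'i \<Rightarrow> 'a::topological_space \<Rightarrow> 'b::real_normed_vector"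
  assumes lin: "\<forall>\<^sub>F x in A. \<forall>i. linear (\<lambda>h. F h i x)"
    and bd: "\<And>h. \<exists>M. \<forall>\<^sub>F x in A. \<forall>i. norm (F h i x) \<le> M * \<omega> i"
    and \<omega>: "\<And>i. 0 \<le> \<omega> i"
  shows "\<exists>M. \<forall>\<^sub>F x in A. \<forall>h i. norm (F h i x) \<le> M * norm h * \<omega> i"
proof -
  obtain B :: "'h set" where B: "finite B" "\<And>b. b \<in> B \<Longrightarrow> norm b = 1"
    "\<And>x. x = (\<Sum>b\<in>B. (x \<bullet> b) *\<^sub>R b)"
    using finite_dim_orthonormal by blast
  obtain M where M: "\<And>h. \<forall>\<^sub>F x in A. \<forall>i. norm (F h i x) \<le> M h * \<omega> i"
    using bd by metis
  have "\<forall>\<^sub>F x in A. \<forall>b\<in>B. \<forall>i. norm (F b i x) \<le> M b * \<omega> i"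
    using M B(1) by (simp add: eventually_ball_finite)
  with lin have "\<forall>\<^sub>F x in A. \<forall>h i. norm (F h i x) \<le> (\<Sum>b\<in>B. M b) * norm h * \<omega> i"
  proof eventually_elim
    case (elim x)
    show ?case
    proof (intro allI)
      fix h i
      from elim(1) interpret linear "\<lambda>h. F h i x" by simp
      have "F h i x = (\<Sum>b\<in>B. (h \<bullet> b) *\<^sub>R F b i x)"
        by (subst B(3)[of h]) (simp add: sum scale)
      also have "norm \<dots> \<le> (\<Sum>b\<in>B. norm h * (M b * \<omega> i))"
      proof (intro sum_norm_le)
        fix b assume b: "b \<in> B"
        have "\<bar>h \<bullet> b\<bar> \<le> norm h" using Cauchy_Schwarz_ineq2[of h b] B(2)[OF b] by simp
        then show "norm ((h \<bullet> b) *\<^sub>R F b i x) \<le> norm h * (M b * \<omega> i)"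
          using elim(2) b by (auto intro!: mult_mono)
      qed
      also have "\<dots> = (\<Sum>b\<in>B. M b) * norm h * \<omega> i"
        by (simp add: sum_distrib_left sum_distrib_right mult_ac)
      finally show "norm (F h i x) \<le> (\<Sum>b\<in>B. M b) * norm h * \<omega> i" .
    qed
  qed
  then show ?thesis by blast
qed


section \<open>Calculus of smooth maps\<close>

abbreviation dir_deriv :: "('a::real_normed_vector \<Rightarrow> 'b::real_normed_vector) \<Rightarrow> 'a \<Rightarrow> 'a \<Rightarrow> 'b" where
  "dir_deriv f h \<equiv> \<lambda>x. frechet_derivative f (at x) h"

lemma dir_deriv_eq: "(f has_derivative f') (at x) \<Longrightarrow> dir_deriv f h x = f' h"
  using frechet_derivative_at by metis

lemma differentiable_cong_open:
  assumes "open S" "x \<in> S" "\<And>x. x \<in> S \<Longrightarrow> f x = g x" "f differentiable (at x)"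
  shows "g differentiable (at x)"
  using assms has_derivative_transform_within_open unfolding differentiable_def by metis

lemma Ck_on_cong:
  assumes "open S" "\<And>x. x \<in> S \<Longrightarrow> f x = g x" "Ck_on k f S"
  shows "Ck_on k g S"
  using assms(2,3)
proof (induction k arbitrary: f g)
  case 0
  then show ?case by (auto cong: continuous_on_cong)
next
  case (Suc k)
  have d: "g differentiable (at x)" if "x \<in> S" for x
    using differentiable_cong_open[OF assms(1) that] Suc.prems that by auto
  have "dir_deriv f h x = dir_deriv g h x" if "x \<in> S" for x h
    using frechet_derivative_transform_within_open[of f x S g] Suc.prems that assms(1) by auto
  then have "Ck_on k (dir_deriv g h) S" for h
    using Suc.IH[of "dir_deriv f h" "dir_deriv g h"] Suc.prems by simp
  then show ?case using d by simp
qed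

lemma Ck_on_subset: "Ck_on k f S \<Longrightarrow> T \<subseteq> S \<Longrightarrow> Ck_on k f T"
  by (induction k arbitrary: f) (auto intro: continuous_on_subset)

lemma Ck_on_local:
  assumes "\<And>x. x \<in> S \<Longrightarrow> \<exists>W. open W \<and> x \<in> W \<and> Ck_on k f W"
  shows "Ck_on k f S"
  using assms
proof (induction k arbitrary: f)
  case 0
  then show ?case
    by (auto intro!: continuous_at_imp_continuous_on) (metis continuous_on_eq_continuous_at)
next
  case (Suc k)
  have "f differentiable (at x)" if "x \<in> S" for x
    using Suc.prems[OF that] by auto
  moreover have "Ck_on k (dir_deriv f h) S" for h
  proof (rule Suc.IH)
    fix x assume "x \<in> S"
    then show "\<exists>W. open W \<and> x \<in> W \<and> Ck_on k (dir_deriv f h) W"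
      using Suc.prems[of x] by auto
  qed
  ultimately show ?case by simp
qed

lemma Ck_on_SucD: "Ck_on (Suc k) f S \<Longrightarrow> Ck_on k f S"
proof (induction k arbitrary: f)
  case 0
  then show ?case
    by (auto intro!: continuous_at_imp_continuous_on dest: differentiable_imp_continuous_within)
next
  case (Suc k)
  have "Ck_on k (dir_deriv f h) S" for h
    using Suc.IH[of "dir_deriv f h"] Suc.prems unfolding Ck_on.simps(2)[of "Suc k"] by blast
  moreover have "\<forall>x\<in>S. f differentiable (at x)"
    using Suc.prems unfolding Ck_on.simps(2)[of "Suc k"] by blast
  ultimately show ?case by simp
qed

lemma Ck_on_differentiable: "Ck_on (Suc k) f S \<Longrightarrow> x \<in> S \<Longrightarrow> f differentiable (at x)"
  by simp

lemma Ck_on_has_derivative: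
  "Ck_on (Suc k) f S \<Longrightarrow> x \<in> S \<Longrightarrow> (f has_derivative frechet_derivative f (at x)) (at x)"
  by (simp add: frechet_derivative_works)

lemma Ck_on_dir_deriv: "Ck_on (Suc k) f S \<Longrightarrow> Ck_on k (dir_deriv f h) S"
  by simp

text \<open>Lets the rules below work with an explicit derivative formula in place of the choice
  made by \<open>frechet_derivative\<close>; openness of \<open>S\<close> makes the two
  interchangeable in higher derivatives.\<close>

lemma Ck_on_SucI:
  assumes "open S" "\<And>x. x \<in> S \<Longrightarrow> (f has_derivative f' x) (at x)"
    "\<And>h. Ck_on k (\<lambda>x. f' x h) S"
  shows "Ck_on (Suc k) f S"
proof -
  have "dir_deriv f h x = f' x h" if "x \<in> S" for x h
    using dir_deriv_eq[OF assms(2)[OF that]] .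
  then have "Ck_on k (dir_deriv f h) S" for h
    by (intro Ck_on_cong[OF assms(1) _ assms(3)]) simp
  moreover have "\<forall>x\<in>S. f differentiable (at x)"
    using assms(2) unfolding differentiable_def by blast
  ultimately show ?thesis by simp
qed

lemma Ck_on_const: "Ck_on k (\<lambda>x. c) S"
  by (induction k arbitrary: c) auto

lemma Ck_on_add:
  assumes "open S" "Ck_on k f S" "Ck_on k g S"
  shows "Ck_on k (\<lambda>x. f x + g x) S"
  using assms(2,3)
proof (induction k arbitrary: f g)
  case (Suc k)
  show ?case
    by (rule Ck_on_SucI[OF assms(1) has_derivative_add[OF Ck_on_has_derivative[OF Suc.prems(1)]
            Ck_on_has_derivative[OF Suc.prems(2)]]])
      (assumption | intro Suc.IH Ck_on_dir_deriv[OF Suc.prems(1)] Ck_on_dir_deriv[OF Suc.prems(2)])+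
qed (simp add: continuous_on_add)

lemma Ck_on_sum:
  assumes "open S" "\<And>i. i \<in> I \<Longrightarrow> Ck_on k (f i) S"
  shows "Ck_on k (\<lambda>x. \<Sum>i\<in>I. f i x) S"
  using assms(2)
  by (induction I rule: infinite_finite_induct) (auto intro: Ck_on_const Ck_on_add[OF assms(1)])

text \<open>In the product rule one factor stays undifferentiated, so the induction also needs that
  a map of class \<open>k + 1\<close> is of class \<open>k\<close>.\<close>

lemma Ck_on_bilinear:
  assumes "bounded_bilinear pr" "open S" "Ck_on k f S" "Ck_on k g S"
  shows "Ck_on k (\<lambda>x. pr (f x) (g x)) S"
  using assms(3,4)
proof (induction k arbitrary: f g)
  case 0
  then show ?case using bounded_bilinear.continuous_on[OF assms(1)] by auto
next
  case (Suc k)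
  show ?case
    by (rule Ck_on_SucI[OF assms(2) bounded_bilinear.FDERIV[OF assms(1)
          Ck_on_has_derivative[OF Suc.prems(1)] Ck_on_has_derivative[OF Suc.prems(2)]]])
      (assumption | intro Ck_on_add[OF assms(2)] Suc.IH Ck_on_dir_deriv[OF Suc.prems(1)]
        Ck_on_dir_deriv[OF Suc.prems(2)] Ck_on_SucD[OF Suc.prems(1)] Ck_on_SucD[OF Suc.prems(2)])+
qed

lemma Ck_on_linear_comp:
  assumes "bounded_linear L" "open S" "Ck_on k f S"
  shows "Ck_on k (\<lambda>x. L (f x)) S"
  using assms(3)
proof (induction k arbitrary: f)
  case 0
  then show ?case using bounded_linear.continuous_on[OF assms(1)] by auto
next
  case (Suc k)
  show ?case
    by (rule Ck_on_SucI[OF assms(2) bounded_linear.has_derivative[OF assms(1)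
          Ck_on_has_derivative[OF Suc.prems]]])
      (assumption | intro Suc.IH Ck_on_dir_deriv[OF Suc.prems])+
qed

lemma Ck_on_Pair:
  assumes "open S" "Ck_on k f S" "Ck_on k g S"
  shows "Ck_on k (\<lambda>x. (f x, g x)) S"
  using assms(2,3)
proof (induction k arbitrary: f g)
  case (Suc k)
  show ?case
    by (rule Ck_on_SucI[OF assms(1) has_derivative_Pair[OF Ck_on_has_derivative[OF Suc.prems(1)]
            Ck_on_has_derivative[OF Suc.prems(2)]]])
      (assumption | intro Suc.IH Ck_on_dir_deriv[OF Suc.prems(1)] Ck_on_dir_deriv[OF Suc.prems(2)])+
qed (simp add: continuous_on_Pair)

text \<open>
  The chain rule expresses a directional derivative of \<open>g \<circ> f\<close> through the partial derivatives
  of \<open>g\<close> in finitely many fixed directions, which is what makes the induction on \<open>k\<close> work.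
\<close>

lemma Ck_on_compose:
  fixes f :: "'a::real_normed_vector \<Rightarrow> 'b::finite_dim_inner" and g :: "'b \<Rightarrow> 'c::real_normed_vector"
  assumes "open S" "Ck_on k f S" "Ck_on k g T" "f ` S \<subseteq> T"
  shows "Ck_on k (\<lambda>x. g (f x)) S"
  using assms(2,3)
proof (induction k arbitrary: g)
  case 0
  then show ?case using continuous_on_compose2 assms(4) by auto
next
  case (Suc k)
  obtain B :: "'b set" where B: "\<And>x. x = (\<Sum>b\<in>B. (x \<bullet> b) *\<^sub>R b)"
    using finite_dim_orthonormal by blast
  let ?D = "\<lambda>x h. \<Sum>b\<in>B. (dir_deriv f h x \<bullet> b) *\<^sub>R dir_deriv g b (f x)"
  show ?case
  proof (rule Ck_on_SucI[OF assms(1), where f' = ?D])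
    fix x assume x: "x \<in> S"
    then have fx: "f x \<in> T" using assms(4) by auto
    have g': "linear (frechet_derivative g (at (f x)))"
      using linear_frechet_derivative Ck_on_differentiable[OF Suc.prems(2) fx] .
    have "frechet_derivative g (at (f x)) (dir_deriv f h x) = ?D x h" for h
      by (subst B[of "dir_deriv f h x"]) (simp add: linear_sum[OF g'] linear_scale[OF g'])
    moreover have "((\<lambda>x. g (f x)) has_derivative (\<lambda>h. frechet_derivative g (at (f x)) (dir_deriv f h x))) (at x)"
      by (rule has_derivative_compose[OF Ck_on_has_derivative[OF Suc.prems(1) x] Ck_on_has_derivative[OF Suc.prems(2) fx]])
    ultimately show "((\<lambda>x. g (f x)) has_derivative ?D x) (at x)" by simp
  next
    fix h
    show "Ck_on k (\<lambda>x. ?D x h) S"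
      by (intro Ck_on_sum[OF assms(1)] Ck_on_bilinear[OF bounded_bilinear_scaleR assms(1)]
          Ck_on_linear_comp[OF bounded_linear_inner_left assms(1)]
          Ck_on_dir_deriv[OF Suc.prems(1)] Suc.IH Ck_on_SucD[OF Suc.prems(1)]
          Ck_on_dir_deriv[OF Suc.prems(2)])
  qed
qed

lemma smooth_on_cong: "open S \<Longrightarrow> (\<And>x. x \<in> S \<Longrightarrow> f x = g x) \<Longrightarrow> smooth_on S f \<Longrightarrow> smooth_on S g"
  unfolding smooth_on_def by (intro allI) (rule Ck_on_cong[of S f], auto)

lemma smooth_on_subset: "smooth_on S f \<Longrightarrow> T \<subseteq> S \<Longrightarrow> smooth_on T f"
  unfolding smooth_on_def using Ck_on_subset by blast

lemma smooth_on_local: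
  "(\<And>x. x \<in> S \<Longrightarrow> \<exists>W. open W \<and> x \<in> W \<and> smooth_on W f) \<Longrightarrow> smooth_on S f"
  unfolding smooth_on_def by (intro allI Ck_on_local) blast

lemma smooth_on_continuous: "smooth_on S f \<Longrightarrow> continuous_on S f"
  unfolding smooth_on_def by (metis Ck_on.simps(1))

lemma smooth_on_const: "smooth_on S (\<lambda>x. c)"
  by (simp add: smooth_on_def Ck_on_const)

lemma smooth_on_Pair:
  "open S \<Longrightarrow> smooth_on S f \<Longrightarrow> smooth_on S g \<Longrightarrow> smooth_on S (\<lambda>x. (f x, g x))"
  by (simp add: smooth_on_def Ck_on_Pair)

lemma smooth_on_linear_comp:
  "bounded_linear L \<Longrightarrow> open S \<Longrightarrow> smooth_on S f \<Longrightarrow> smooth_on S (\<lambda>x. L (f x))"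
  by (simp add: smooth_on_def Ck_on_linear_comp)

lemma smooth_on_ident: "smooth_on S (\<lambda>x. x)"
  unfolding smooth_on_def
proof
  show "Ck_on k (\<lambda>x. x) S" for k
    by (cases k) (auto simp: Ck_on_const)
qed

lemma smooth_on_linear: "bounded_linear L \<Longrightarrow> open S \<Longrightarrow> smooth_on S L"
  using smooth_on_linear_comp smooth_on_ident by blast

lemma smooth_on_compose:
  fixes f :: "'a::real_normed_vector \<Rightarrow> 'b::finite_dim_inner" and g :: "'b \<Rightarrow> 'c::real_normed_vector"
  shows "open S \<Longrightarrow> smooth_on S f \<Longrightarrow> smooth_on T g \<Longrightarrow> f ` S \<subseteq> T \<Longrightarrow> smooth_on S (\<lambda>x. g (f x))"
  unfolding smooth_on_def by (intro allI) (rule Ck_on_compose[of S], auto)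


section \<open>Smooth maps in charts\<close>

text \<open>
  In contrast to \<^const>\<open>smooth_map\<close>, which provides one chart of the target around each value,
  \<open>smooth_into\<close> quantifies over all charts of the atlas; this is the form that composes.
\<close>

definition smooth_into ::
  "('a, 'e::real_normed_vector) chart set \<Rightarrow> 'x::real_normed_vector set \<Rightarrow> ('x \<Rightarrow> 'a) \<Rightarrow> bool" where
  "smooth_into A S f \<longleftrightarrow> (\<forall>x\<in>S. \<forall>(D, c)\<in>A. f x \<in> D \<longrightarrow>
     (\<exists>W. open W \<and> x \<in> W \<and> W \<subseteq> S \<and> f ` W \<subseteq> D \<and> smooth_on W (\<lambda>y. c (f y))))"

lemma smooth_intoD:
  assumes "smooth_into A S f" "x \<in> S" "(D, c) \<in> A" "f x \<in> D"
  obtains W where "open W" "x \<in> W" "W \<subseteq> S" "f ` W \<subseteq> D" "smooth_on W (\<lambda>y. c (f y))"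
proof -
  have "\<exists>W. open W \<and> x \<in> W \<and> W \<subseteq> S \<and> f ` W \<subseteq> D \<and> smooth_on W (\<lambda>y. c (f y))"
    using assms unfolding smooth_into_def by fast
  then show ?thesis using that by blast
qed

lemma smooth_mapD:
  assumes "smooth_map A S B f" "x \<in> S"
  obtains D c D' c' W F where "(D, c) \<in> A" "(D', c') \<in> B" "x \<in> D" "f x \<in> D'" "open W" "c x \<in> W"
    "smooth_on W F" "\<forall>y\<in>S \<inter> D. c y \<in> W \<longrightarrow> f y \<in> D' \<and> c' (f y) = F (c y)"
proof -
  have "\<exists>(D, c)\<in>A. \<exists>(D', c')\<in>B. \<exists>W F.
        x \<in> D \<and> f x \<in> D' \<and> open W \<and> c x \<in> W \<and> smooth_on W F \<and>
        (\<forall>y\<in>S \<inter> D. c y \<in> W \<longrightarrow> f y \<in> D' \<and> c' (f y) = F (c y))"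
    using assms unfolding smooth_map_def by simp
  then show ?thesis using that by (auto split: prod.splits)
qed

lemma smooth_mapI:
  assumes "\<And>x. x \<in> S \<Longrightarrow> \<exists>D c D' c' W F. (D, c) \<in> A \<and> (D', c') \<in> B \<and> x \<in> D \<and> f x \<in> D' \<and>
    open W \<and> c x \<in> W \<and> smooth_on W F \<and> (\<forall>y\<in>S \<inter> D. c y \<in> W \<longrightarrow> f y \<in> D' \<and> c' (f y) = F (c y))"
  shows "smooth_map A S B f"
  unfolding smooth_map_def
proof
  fix x assume x: "x \<in> S"
  obtain D c D' c' W F where *: "(D, c) \<in> A \<and> (D', c') \<in> B \<and> x \<in> D \<and> f x \<in> D' \<and> open W \<and> c x \<in> W \<and>
      smooth_on W F \<and> (\<forall>y\<in>S \<inter> D. c y \<in> W \<longrightarrow> f y \<in> D' \<and> c' (f y) = F (c y))"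
    using assms[OF x] by (elim exE) (rule that)
  show "\<exists>(D, c)\<in>A. \<exists>(D', c')\<in>B. \<exists>W F. x \<in> D \<and> f x \<in> D' \<and> open W \<and> c x \<in> W \<and> smooth_on W F \<and>
      (\<forall>y\<in>S \<inter> D. c y \<in> W \<longrightarrow> f y \<in> D' \<and> c' (f y) = F (c y))"
    by (rule bexI[OF _ conjunct1[OF *]], unfold prod.case,
        rule bexI[OF _ conjunct1[OF conjunct2[OF *]]], unfold prod.case, intro exI,
        rule conjunct2[OF conjunct2[OF *]])
qed

lemma smooth_map_from_flatD:
  assumes "smooth_map flat_atlas S B f" "x \<in> S" "open S"
  obtains D c W where "(D, c) \<in> B" "open W" "x \<in> W" "W \<subseteq> S" "f ` W \<subseteq> D"
    "smooth_on W (\<lambda>y. c (f y))"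
proof -
  obtain D c D' c' W F where *: "(D, c) \<in> flat_atlas" "(D', c') \<in> B" "x \<in> D" "f x \<in> D'" "open W" "c x \<in> W"
    "smooth_on W F" "\<forall>y\<in>S \<inter> D. c y \<in> W \<longrightarrow> f y \<in> D' \<and> c' (f y) = F (c y)"
    using smooth_mapD[OF assms(1,2)] .
  have c: "c y = y" and D: "D = UNIV" for y using *(1) by (simp_all add: flat_atlas_def)
  have W: "open (W \<inter> S)" using *(5) assms(3) by (rule open_Int)
  have eq: "f y \<in> D' \<and> F y = c' (f y)" if "y \<in> W \<inter> S" for y
    using bspec[OF *(8), of y] that c[of y] D by simp
  have "smooth_on (W \<inter> S) F" by (rule smooth_on_subset[OF *(7) Int_lower1])
  then have "smooth_on (W \<inter> S) (\<lambda>y. c' (f y))"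
    by (rule smooth_on_cong[OF W, rotated]) (simp add: eq)
  moreover have "x \<in> W \<inter> S" using *(6) c[of x] assms(2) by simp
  moreover have "f ` (W \<inter> S) \<subseteq> D'" using eq by (simp add: image_subset_iff)
  ultimately show ?thesis
    using that[OF *(2) W _ Int_lower2] by simp
qed

lemma smooth_map_flat_onD:
  assumes "smooth_map flat_atlas S flat_atlas f" "open S"
  shows "smooth_on S f"
proof (rule smooth_on_local)
  fix x assume x: "x \<in> S"
  obtain D c W where *: "(D, c) \<in> flat_atlas" "open W" "x \<in> W" "W \<subseteq> S" "f ` W \<subseteq> D"
    "smooth_on W (\<lambda>y. c (f y))"
    using smooth_map_from_flatD[OF assms(1) x assms(2)] .
  have "(\<lambda>y. c (f y)) = f" using *(1) by (simp add: flat_atlas_def)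
  then show "\<exists>W. open W \<and> x \<in> W \<and> smooth_on W f" using *(2,3,6) by metis
qed

section \<open>Change of charts and composition of smooth maps\<close>

lemma smooth_manifold_chartD:
  assumes "smooth_manifold X A" "(D, c) \<in> A"
  shows "openin X D" "inj_on c D" "openin X N \<Longrightarrow> open (c ` (D \<inter> N))"
proof -
  have *: "openin X D" "open (c ` D)" "homeomorphic_map (subtopology X D) (top_of_set (c ` D)) c"
    using assms unfolding smooth_manifold_def by blast+
  have sub: "D \<subseteq> topspace X" using *(1) by (rule openin_subset)
  show "openin X D" by fact
  show "inj_on c D"
    using homeomorphic_imp_injective_map[OF *(3)] sub by (simp add: Int_absorb1)
  assume N: "openin X N"
  have "openin (subtopology X D) (D \<inter> N)" using N by (auto simp: openin_subtopology)
  then have "openin (top_of_set (c ` D)) (c ` (D \<inter> N))"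
    using homeomorphic_imp_open_map[OF *(3)] unfolding open_map_def by blast
  then show "open (c ` (D \<inter> N))" using *(2) openin_open_trans by blast
qed

lemma smooth_manifold_transition:
  assumes "smooth_manifold X A" "(D, c) \<in> A" "(D', c') \<in> A"
  shows "smooth_on (c ` (D \<inter> D')) (\<lambda>z. c' (inv_into D c z))"
proof -
  have "smooth_on (c ` (D \<inter> D')) (c' \<circ> inv_into D c)"
    using assms unfolding smooth_manifold_def by fast
  then show ?thesis by (simp add: comp_def)
qed

lemma smooth_manifold_cover:
  assumes "smooth_manifold X A" "x \<in> topspace X"
  obtains D c where "(D, c) \<in> A" "x \<in> D"
  using assms unfolding smooth_manifold_def by blast

lemma smooth_on_open_vimage:
  assumes "open W" "smooth_on W F" "open T"
  shows "open {z \<in> W. F z \<in> T}"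
proof -
  have "open (W \<inter> F -` T)"
    using continuous_open_preimage[OF smooth_on_continuous[OF assms(2)] assms(1,3)] .
  moreover have "W \<inter> F -` T = {z \<in> W. F z \<in> T}" by auto
  ultimately show ?thesis by simp
qed

text \<open>The one chart supplied by \<open>smooth_map\<close> is converted into an arbitrary chart
  by the transition map, which is smooth by compatibility of the atlas.\<close>

lemma smooth_map_imp_smooth_into:
  fixes A :: "('a, 'e::finite_dim_inner) chart set"
  assumes X: "smooth_manifold X A" and f: "smooth_map flat_atlas S A f" and S: "open S"
  shows "smooth_into A S f"
  unfolding smooth_into_def
proof (clarify)
  fix x D c assume x: "x \<in> S" and c: "(D, c) \<in> A" and fx: "f x \<in> D"
  obtain D1 c1 W where c1: "(D1, c1) \<in> A" and W: "open W" "x \<in> W" "W \<subseteq> S" "f ` W \<subseteq> D1"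
    "smooth_on W (\<lambda>y. c1 (f y))"
    using smooth_map_from_flatD[OF f x S] .
  \<comment> \<open>Asking for the coordinate to lie in the image of the overlap gives an open
    condition; injectivity of \<open>c1\<close> on \<open>D1\<close> then puts \<open>f y\<close>
    itself into the overlap.\<close>
  let ?W = "{y \<in> W. c1 (f y) \<in> c1 ` (D1 \<inter> D)}"
  have inj: "inj_on c1 D1" using smooth_manifold_chartD[OF X c1] by simp
  have oW: "open ?W"
    using W(1,5) smooth_manifold_chartD(3)[OF X c1 smooth_manifold_chartD(1)[OF X c]]
    by (rule smooth_on_open_vimage)
  have sub: "f y \<in> D1 \<inter> D" if "y \<in> ?W" for y
  proof -
    obtain z where z: "z \<in> D1 \<inter> D" "c1 (f y) = c1 z" using \<open>y \<in> ?W\<close> by blast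
    moreover have "f y \<in> D1" using \<open>y \<in> ?W\<close> W(4) by blast
    ultimately have "f y = z" using inj_onD[OF inj] by blast
    with z show ?thesis by simp
  qed
  have "smooth_on ?W (\<lambda>y. c (inv_into D1 c1 (c1 (f y))))"
    by (rule smooth_on_compose[OF oW smooth_on_subset[OF W(5) Collect_restrict]
        smooth_manifold_transition[OF X c1 c]]) (simp add: image_subset_iff)
  then have "smooth_on ?W (\<lambda>y. c (f y))"
  proof (rule smooth_on_cong[OF oW, rotated])
    fix y assume "y \<in> ?W"
    then show "c (inv_into D1 c1 (c1 (f y))) = c (f y)"
      using inv_into_f_f[OF inj] sub by (metis IntD1)
  qed
  moreover have "x \<in> ?W" using W(2,4) fx by blast
  moreover have "f ` ?W \<subseteq> D" using sub by (meson IntD2 image_subsetI)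
  moreover have "?W \<subseteq> S" using W(3) by blast
  ultimately show "\<exists>W. open W \<and> x \<in> W \<and> W \<subseteq> S \<and> f ` W \<subseteq> D \<and> smooth_on W (\<lambda>y. c (f y))"
    using oW by (intro exI[of _ ?W] conjI)
qed

text \<open>The set \<open>M\<close> may be any subset: in charts \<open>g\<close> is the
  restriction of a smooth \<open>F\<close> on an open set, and \<open>F\<close> is composed with the
  chart expression of \<open>f\<close>. This is how the product, known on composable pairs only,
  becomes a smooth map on an open set.\<close>

lemma smooth_map_compose:
  fixes A :: "('a, 'e::finite_dim_inner) chart set"
  assumes f: "smooth_into A S f" and g: "smooth_map A M B g" and sub: "f ` S \<subseteq> M"
  shows "smooth_map flat_atlas S B (\<lambda>x. g (f x))"
proof (rule smooth_mapI)
  fix x assume x: "x \<in> S"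
  then have fx: "f x \<in> M" using sub by auto
  obtain D c D' c' W F where c: "(D, c) \<in> A" "(D', c') \<in> B" and W: "f x \<in> D" "g (f x) \<in> D'"
    "open W" "c (f x) \<in> W" "smooth_on W F"
    "\<forall>y\<in>M \<inter> D. c y \<in> W \<longrightarrow> g y \<in> D' \<and> c' (g y) = F (c y)"
    using smooth_mapD[OF g fx] .
  obtain W1 where W1: "open W1" "x \<in> W1" "W1 \<subseteq> S" "f ` W1 \<subseteq> D" "smooth_on W1 (\<lambda>y. c (f y))"
    using smooth_intoD[OF f x c(1) W(1)] .
  let ?W = "{y \<in> W1. c (f y) \<in> W}"
  have oW: "open ?W" by (rule smooth_on_open_vimage[OF W1(1,5) W(3)])
  have "smooth_on ?W (\<lambda>y. F (c (f y)))"
    by (rule smooth_on_compose[OF oW smooth_on_subset[OF W1(5) Collect_restrict] W(5)])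
      (simp add: image_subset_iff)
  moreover have "\<forall>y\<in>S \<inter> UNIV. y \<in> ?W \<longrightarrow> g (f y) \<in> D' \<and> c' (g (f y)) = F (c (f y))"
    using W(6) W1(3,4) sub by blast
  moreover have "x \<in> ?W" using W(4) W1(2) by simp
  moreover have "(UNIV, \<lambda>x. x) \<in> flat_atlas" by (simp add: flat_atlas_def)
  ultimately show "\<exists>D c D' c' W F. (D, c) \<in> flat_atlas \<and> (D', c') \<in> B \<and> x \<in> D \<and> g (f x) \<in> D' \<and>
    open W \<and> c x \<in> W \<and> smooth_on W F \<and> (\<forall>y\<in>S \<inter> D. c y \<in> W \<longrightarrow> g (f y) \<in> D' \<and> c' (g (f y)) = F (c y))"
    using oW W(2) c(2)
    by (intro exI[of _ UNIV] exI[of _ "\<lambda>x. x"] exI[of _ D'] exI[of _ c'] exI[of _ ?W]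
        exI[of _ "\<lambda>y. F (c (f y))"] conjI) simp_all
qed

lemma smooth_into_compose_on:
  fixes h :: "'x::real_normed_vector \<Rightarrow> 'y::finite_dim_inner"
  assumes f: "smooth_into A P f" and h: "smooth_on S h" "h ` S \<subseteq> P" "open S"
  shows "smooth_into A S (\<lambda>x. f (h x))"
  unfolding smooth_into_def
proof (clarify)
  fix x D c assume x: "x \<in> S" and c: "(D, c) \<in> A" and fx: "f (h x) \<in> D"
  have hx: "h x \<in> P" using h x by auto
  obtain W where W: "open W" "h x \<in> W" "W \<subseteq> P" "f ` W \<subseteq> D" "smooth_on W (\<lambda>y. c (f y))"
    using smooth_intoD[OF f hx c fx] .
  let ?W = "{y \<in> S. h y \<in> W}"
  have oW: "open ?W" by (rule smooth_on_open_vimage[OF h(3,1) W(1)])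
  have "smooth_on ?W (\<lambda>y. c (f (h y)))"
    by (rule smooth_on_compose[OF oW smooth_on_subset[OF h(1) Collect_restrict] W(5)])
      (simp add: image_subset_iff)
  then show "\<exists>W. open W \<and> x \<in> W \<and> W \<subseteq> S \<and> (\<lambda>x. f (h x)) ` W \<subseteq> D \<and> smooth_on W (\<lambda>y. c (f (h y)))"
    using oW W(4) x W(2) by (intro exI[of _ ?W] conjI) (assumption | blast)+
qed

lemma smooth_into_Pair:
  assumes f: "smooth_into A S f" and g: "smooth_into B S g"
  shows "smooth_into (product_atlas A B) S (\<lambda>x. (f x, g x))"
  unfolding smooth_into_def
proof (clarify)
  fix x D c assume x: "x \<in> S" and c: "(D, c) \<in> product_atlas A B" and fx: "(f x, g x) \<in> D"
  obtain D1 c1 D2 c2 where D: "D = D1 \<times> D2" "c = map_prod c1 c2" and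
    c12: "(D1, c1) \<in> A" "(D2, c2) \<in> B"
    using c by (auto simp: product_atlas_def)
  obtain W1 where W1: "open W1" "x \<in> W1" "W1 \<subseteq> S" "f ` W1 \<subseteq> D1" "smooth_on W1 (\<lambda>y. c1 (f y))"
    using smooth_intoD[OF f x c12(1)] fx D by auto
  obtain W2 where W2: "open W2" "x \<in> W2" "W2 \<subseteq> S" "g ` W2 \<subseteq> D2" "smooth_on W2 (\<lambda>y. c2 (g y))"
    using smooth_intoD[OF g x c12(2)] fx D by auto
  have oW: "open (W1 \<inter> W2)" using W1 W2 by auto
  have "smooth_on (W1 \<inter> W2) (\<lambda>y. (c1 (f y), c2 (g y)))"
    by (rule smooth_on_Pair[OF oW smooth_on_subset[OF W1(5) Int_lower1]
        smooth_on_subset[OF W2(5) Int_lower2]])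
  then show "\<exists>W. open W \<and> x \<in> W \<and> W \<subseteq> S \<and> (\<lambda>x. (f x, g x)) ` W \<subseteq> D \<and>
      smooth_on W (\<lambda>y. c (f y, g y))"
    using oW W1(2-4) W2(2-4) by (intro exI[of _ "W1 \<inter> W2"] conjI) (simp_all add: D image_subset_iff le_infI1)
qed

lemma smooth_into_subset:
  assumes "smooth_into A S f" "T \<subseteq> S" "open T"
  shows "smooth_into A T f"
  unfolding smooth_into_def
proof (clarify)
  fix x D c assume x: "x \<in> T" and c: "(D, c) \<in> A" and fx: "f x \<in> D"
  have "x \<in> S" using x assms(2) by blast
  then obtain W where W: "open W" "x \<in> W" "W \<subseteq> S" "f ` W \<subseteq> D" "smooth_on W (\<lambda>y. c (f y))"
    using smooth_intoD[OF assms(1) _ c fx] by metis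
  then show "\<exists>W. open W \<and> x \<in> W \<and> W \<subseteq> T \<and> f ` W \<subseteq> D \<and> smooth_on W (\<lambda>y. c (f y))"
    using x assms(3) smooth_on_subset[OF W(5) Int_lower1] W(1,2,4)
    by (intro exI[of _ "W \<inter> T"] conjI) (simp_all add: open_Int image_subset_iff)
qed

text \<open>Continuity for the topology of the manifold; it yields the openness of
  \<open>product_domain\<close>.\<close>

lemma smooth_into_open_vimage:
  assumes X: "smooth_manifold X A" and f: "smooth_into A S f" and N: "openin X N"
  shows "open {x \<in> S. f x \<in> N}"
proof (subst open_subopen, intro ballI)
  fix x assume "x \<in> {x \<in> S. f x \<in> N}"
  then have x: "x \<in> S" "f x \<in> N" by auto
  then obtain D c where c: "(D, c) \<in> A" "f x \<in> D"
    using smooth_manifold_cover[OF X] openin_subset[OF N] by blast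
  obtain W where W: "open W" "x \<in> W" "W \<subseteq> S" "f ` W \<subseteq> D" "smooth_on W (\<lambda>y. c (f y))"
    using smooth_intoD[OF f x(1) c] .
  let ?W = "{y \<in> W. c (f y) \<in> c ` (D \<inter> N)}"
  have inj: "inj_on c D" using smooth_manifold_chartD[OF X c(1)] by simp
  have "open ?W"
    by (rule smooth_on_open_vimage[OF W(1,5) smooth_manifold_chartD(3)[OF X c(1) N]])
  moreover have "?W \<subseteq> {x \<in> S. f x \<in> N}"
  proof
    fix y assume y: "y \<in> ?W"
    then obtain z where z: "z \<in> D" "z \<in> N" "c (f y) = c z" by auto
    moreover have "f y \<in> D" using y W(4) by auto
    ultimately have "f y = z" using inj by (auto simp: inj_on_def)
    with z y W(3) show "y \<in> {x \<in> S. f x \<in> N}" by auto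
  qed
  ultimately show "\<exists>T. open T \<and> x \<in> T \<and> T \<subseteq> {x \<in> S. f x \<in> N}"
    using x c W(2) by (intro exI[of _ ?W]) auto
qed

text \<open>
  The inclusion of a submanifold is smooth: the inverse of the ambient chart that induces a slice
  chart turns the pair of the slice coordinates and \<open>0\<close> into a point of the ambient manifold.
\<close>

lemma smooth_map_slice_charts_ambient:
  fixes A :: "('a, 'u::finite_dim_inner \<times> 'v::finite_dim_inner) chart set"
    and f :: "'b \<Rightarrow> 'a" and C :: "('b, 'e::finite_dim_inner) chart set"
  assumes X: "smooth_manifold X A" and f: "smooth_map C S (slice_charts X A N) f"
    and N: "N \<subseteq> topspace X"
  shows "smooth_map C S A f"
proof (rule smooth_mapI)
  fix x assume x: "x \<in> S"
  obtain D c D' c' W F where c: "(D, c) \<in> C" "(D', c') \<in> slice_charts X A N" and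
    W: "x \<in> D" "f x \<in> D'" "open W" "c x \<in> W" "smooth_on W F"
    "\<forall>y\<in>S \<inter> D. c y \<in> W \<longrightarrow> f y \<in> D' \<and> c' (f y) = F (c y)"
    using smooth_mapD[OF f x] .
  obtain E and e :: "'a \<Rightarrow> 'u \<times> 'v" where D': "D' = E \<inter> N" "c' = fst \<circ> e" and
    e: "open (e ` E)" "diffeomorphism A E flat_atlas (e ` E) e"
    "e ` (E \<inter> N) = e ` E \<inter> (UNIV \<times> {0})"
    using c(2) unfolding slice_charts_def by blast
  have inj: "inj_on e E" and inv: "smooth_map flat_atlas (e ` E) A (inv_into E e)"
    using e(2) by (auto simp: diffeomorphism_def bij_betw_def)
  have into: "smooth_into A (e ` E) (inv_into E e)"
    by (rule smooth_map_imp_smooth_into[OF X inv e(1)])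
  have slice: "e (f y) = (F (c y), 0)" "f y \<in> E" if "y \<in> S" "y \<in> D" "c y \<in> W" for y
  proof -
    have *: "f y \<in> E \<inter> N" "fst (e (f y)) = F (c y)" using W(6) that D' by auto
    then have "e (f y) \<in> UNIV \<times> {0}" using e(3) by blast
    with * show "e (f y) = (F (c y), 0)" "f y \<in> E" by (auto simp: prod_eq_iff)
  qed
  have fx: "f x \<in> E" "e (f x) = (F (c x), 0)" using slice[OF x W(1,4)] by auto
  obtain D1 c1 where c1: "(D1, c1) \<in> A" "f x \<in> D1"
    using smooth_manifold_cover[OF X] N W(2) D'(1) by blast
  obtain W1 where W1: "open W1" "e (f x) \<in> W1" "W1 \<subseteq> e ` E" "inv_into E e ` W1 \<subseteq> D1"
    "smooth_on W1 (\<lambda>y. c1 (inv_into E e y))"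
    using smooth_intoD[OF into _ c1(1), of "e (f x)"] fx(1) c1(2) inj by auto
  have sF: "smooth_on W (\<lambda>z. (F z, 0::'v))"
    by (rule smooth_on_Pair[OF W(3,5) smooth_on_const])
  let ?W = "{z \<in> W. (F z, 0) \<in> W1}"
  have oW: "open ?W" by (rule smooth_on_open_vimage[OF W(3) sF W1(1)])
  have s: "smooth_on ?W (\<lambda>z. c1 (inv_into E e (F z, 0)))"
    by (rule smooth_on_compose[OF oW smooth_on_subset[OF sF Collect_restrict] W1(5)])
      (simp add: image_subset_iff)
  have eq: "f y \<in> D1 \<and> c1 (f y) = c1 (inv_into E e (F (c y), 0))"
    if y: "y \<in> S" "y \<in> D" "c y \<in> ?W" for y
  proof -
    have cy: "c y \<in> W" "(F (c y), 0) \<in> W1" using y(3) by auto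
    have "inv_into E e (F (c y), 0) = f y"
      using slice[OF y(1,2) cy(1)] inj by (metis inv_into_f_f)
    with cy(2) W1(4) show ?thesis by auto
  qed
  have "\<forall>y\<in>S \<inter> D. c y \<in> ?W \<longrightarrow> f y \<in> D1 \<and> c1 (f y) = c1 (inv_into E e (F (c y), 0))"
    using eq by blast
  moreover have "c x \<in> ?W" using W(4) W1(2) fx(2) by simp
  ultimately show "\<exists>D c D' c' W F. (D, c) \<in> C \<and> (D', c') \<in> A \<and> x \<in> D \<and> f x \<in> D' \<and>
    open W \<and> c x \<in> W \<and> smooth_on W F \<and> (\<forall>y\<in>S \<inter> D. c y \<in> W \<longrightarrow> f y \<in> D' \<and> c' (f y) = F (c y))"
    using oW s W(1) c(1) c1
    by (intro exI[of _ D] exI[of _ c] exI[of _ D1] exI[of _ c1] exI[of _ ?W]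
        exI[of _ "\<lambda>z. c1 (inv_into E e (F z, 0))"] conjI) simp_all
qed


section \<open>Taylor estimates\<close>

text \<open>A derivative is linear in its own direction by definition. For a direction chosen
  earlier, linearity on a whole neighbourhood is differentiated once more.\<close>

lemma linear_dir_deriv_family:
  assumes S: "open S" "x \<in> S" and lin: "\<And>y. y \<in> S \<Longrightarrow> linear (\<lambda>h. g h y)"
    and diff: "\<And>h. g h differentiable (at x)"
  shows "linear (\<lambda>h. dir_deriv (g h) k x)"
proof (rule linearI)
  have g': "(g h has_derivative frechet_derivative (g h) (at x)) (at x)" for h
    using diff frechet_derivative_works by blast
  fix h h' c
  have "(g (h + h') has_derivative (\<lambda>k. dir_deriv (g h) k x + dir_deriv (g h') k x)) (at x)"
    by (rule has_derivative_transform_within_open[OF has_derivative_add[OF g' g'] S])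
      (simp add: linear_add[OF lin])
  then show "dir_deriv (g (h + h')) k x = dir_deriv (g h) k x + dir_deriv (g h') k x"
    by (rule dir_deriv_eq)
  have "(g (c *\<^sub>R h) has_derivative (\<lambda>k. c *\<^sub>R dir_deriv (g h) k x)) (at x)"
    by (rule has_derivative_transform_within_open[OF has_derivative_scaleR_right[OF g'] S])
      (simp add: linear_scale[OF lin])
  then show "dir_deriv (g (c *\<^sub>R h)) k x = c *\<^sub>R dir_deriv (g h) k x"
    by (rule dir_deriv_eq)
qed

lemma linear_dir_deriv: "Ck_on (Suc k) f S \<Longrightarrow> x \<in> S \<Longrightarrow> linear (\<lambda>h. dir_deriv f h x)"
  by (rule linear_frechet_derivative[OF Ck_on_differentiable])

lemma linear_dir_deriv2:
  assumes "open S" "x \<in> S" "Ck_on (Suc (Suc k)) f S"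
  shows "linear (\<lambda>h. dir_deriv (dir_deriv f h) l x)"
  by (rule linear_dir_deriv_family[OF assms(1,2) linear_dir_deriv[OF assms(3)]
        Ck_on_differentiable[OF Ck_on_dir_deriv[OF assms(3)] assms(2)]])

lemma linear_dir_deriv3:
  assumes "open S" "x \<in> S" "Ck_on (Suc (Suc (Suc k))) f S"
  shows "linear (\<lambda>h. dir_deriv (dir_deriv (dir_deriv f h) l) m x)"
  by (rule linear_dir_deriv_family[OF assms(1,2) linear_dir_deriv2[OF assms(1) _ assms(3)]
        Ck_on_differentiable[OF Ck_on_dir_deriv[OF Ck_on_dir_deriv[OF assms(3)]] assms(2)]])

text \<open>Continuity bounds each fixed pair of directions near \<open>x\<close>. Two rounds of
  \<open>eventually_finite_dim_bound\<close> make this uniform, first in \<open>h\<close> with a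
  trivial index of type \<open>unit\<close>, then in \<open>k\<close> with \<open>h\<close> as the
  index.\<close>

lemma eventually_second_deriv_bound:
  fixes f :: "'a::finite_dim_inner \<Rightarrow> 'b::real_normed_vector"
  assumes S: "open S" "x \<in> S" and f: "Ck_on (Suc (Suc 0)) f S"
  shows "\<exists>M. \<forall>\<^sub>F y in nhds x. \<forall>h k. norm (dir_deriv (dir_deriv f k) h y) \<le> M * norm h * norm k"
proof -
  have evS: "\<forall>\<^sub>F y in nhds x. y \<in> S"
    using S by (rule eventually_nhds_in_open)
  have 1: "\<exists>M. \<forall>\<^sub>F y in nhds x. \<forall>i::unit. norm (dir_deriv (dir_deriv f k) h y) \<le> M * 1" for h k
  proof -
    let ?g = "dir_deriv (dir_deriv f k) h"
    have "continuous_on S ?g"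
      using Ck_on_dir_deriv[OF Ck_on_dir_deriv[OF f]] by simp
    then have "isCont ?g x" using S continuous_on_eq_continuous_at by blast
    then have "(?g \<longlongrightarrow> ?g x) (nhds x)"
      using tendsto_at_iff_tendsto_nhds[of ?g x] by (simp add: isCont_def)
    then have "\<forall>\<^sub>F y in nhds x. norm (?g y) < norm (?g x) + 1"
      by (intro order_tendstoD(2)[OF tendsto_norm]) auto
    then have "\<forall>\<^sub>F y in nhds x. \<forall>i::unit. norm (?g y) \<le> (norm (?g x) + 1) * 1"
      by (rule eventually_mono) simp
    then show ?thesis by blast
  qed
  have 2: "\<exists>M. \<forall>\<^sub>F y in nhds x. \<forall>h. norm (dir_deriv (dir_deriv f k) h y) \<le> M * norm h" for k
  proof -
    have "\<forall>\<^sub>F y in nhds x. \<forall>i::unit. linear (\<lambda>h. dir_deriv (dir_deriv f k) h y)"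
      using evS by (rule eventually_mono) (use linear_dir_deriv[OF Ck_on_dir_deriv[OF f]] in blast)
    from eventually_finite_dim_bound[OF this 1] show ?thesis by simp
  qed
  have "\<forall>\<^sub>F y in nhds x. \<forall>h. linear (\<lambda>k. dir_deriv (dir_deriv f k) h y)"
    using evS by (rule eventually_mono) (use linear_dir_deriv2[OF S(1) _ f] in blast)
  from eventually_finite_dim_bound[OF this 2] obtain M where
    "\<forall>\<^sub>F y in nhds x. \<forall>k h. norm (dir_deriv (dir_deriv f k) h y) \<le> M * norm k * norm h"
    by auto
  then have "\<forall>\<^sub>F y in nhds x. \<forall>h k. norm (dir_deriv (dir_deriv f k) h y) \<le> M * norm h * norm k"
    by (rule eventually_mono) (metis mult.commute mult.assoc)
  then show ?thesis by blast
qed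

text \<open>The second-order bound holds for the derivative of \<open>f\<close> in each fixed
  direction \<open>l\<close>; one more round, with the pair \<open>(h, k)\<close> as index, makes it
  uniform in \<open>l\<close>.\<close>

lemma eventually_third_deriv_bound:
  fixes f :: "'a::finite_dim_inner \<Rightarrow> 'b::real_normed_vector"
  assumes S: "open S" "x \<in> S" and f: "Ck_on (Suc (Suc (Suc 0))) f S"
  shows "\<exists>M. \<forall>\<^sub>F y in nhds x. \<forall>h k l.
    norm (dir_deriv (dir_deriv (dir_deriv f l) k) h y) \<le> M * norm h * norm k * norm l"
proof -
  have 1: "\<exists>M. \<forall>\<^sub>F y in nhds x. \<forall>i. norm (dir_deriv (dir_deriv (dir_deriv f l) (snd i)) (fst i) y)
      \<le> M * (norm (fst i) * norm (snd i))" for l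
    using eventually_second_deriv_bound[OF S Ck_on_dir_deriv[OF f], of l] by (simp add: mult.assoc)
  have "\<forall>\<^sub>F y in nhds x. y \<in> S"
    using S by (rule eventually_nhds_in_open)
  then have "\<forall>\<^sub>F y in nhds x. \<forall>i. linear (\<lambda>l. dir_deriv (dir_deriv (dir_deriv f l) (snd i)) (fst i) y)"
    by (rule eventually_mono) (use linear_dir_deriv3[OF S(1) _ f] in blast)
  from eventually_finite_dim_bound[OF this 1] obtain M where
    "\<forall>\<^sub>F y in nhds x. \<forall>l i. norm (dir_deriv (dir_deriv (dir_deriv f l) (snd i)) (fst i) y)
      \<le> M * norm l * (norm (fst i) * norm (snd i))"
    by auto
  then have "\<forall>\<^sub>F y in nhds x. \<forall>h k l.
    norm (dir_deriv (dir_deriv (dir_deriv f l) k) h y) \<le> M * norm h * norm k * norm l"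
  proof (rule eventually_mono, intro allI)
    fix y h k l
    assume "\<forall>l i. norm (dir_deriv (dir_deriv (dir_deriv f l) (snd i)) (fst i) y)
      \<le> M * norm l * (norm (fst i) * norm (snd i))"
    from spec[OF spec[OF this, of l], of "(h, k)"]
    show "norm (dir_deriv (dir_deriv (dir_deriv f l) k) h y) \<le> M * norm h * norm k * norm l"
      by (simp add: mult_ac)
  qed
  then show ?thesis by blast
qed

section \<open>Mean value inequalities along segments\<close>

lemma has_vector_derivative_line:
  assumes "g differentiable (at (x + t *\<^sub>R h))"
  shows "((\<lambda>t. g (x + t *\<^sub>R h)) has_vector_derivative dir_deriv g h (x + t *\<^sub>R h)) (at t)"
proof -
  have g: "(g has_derivative frechet_derivative g (at (x + t *\<^sub>R h))) (at (x + t *\<^sub>R h))"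
    using assms by (simp add: frechet_derivative_works)
  have "((\<lambda>t. x + t *\<^sub>R h) has_derivative (\<lambda>s. s *\<^sub>R h)) (at t)"
    by (auto intro!: derivative_eq_intros)
  from has_derivative_compose[OF this g] show ?thesis
    by (simp add: has_vector_derivative_def linear_scale[OF linear_frechet_derivative[OF assms]])
qed

text \<open>This is the mean value inequality for \<open>f t - t *\<^sub>R b\<close>, which measures
  an increment against its expected value; below \<open>b\<close> is a mixed derivative, a
  difference \<open>w - w'\<close>, or \<open>0\<close>.\<close>

lemma mean_value_unit_interval:
  fixes f :: "real \<Rightarrow> 'b::real_normed_vector"
  assumes f: "\<And>t. t \<in> {0..1} \<Longrightarrow> (f has_vector_derivative f' t) (at t)"
    and C: "\<And>t. t \<in> {0..1} \<Longrightarrow> norm (f' t - b) \<le> C"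
  shows "norm (f 1 - f 0 - b) \<le> C"
proof -
  have "norm ((f 1 - 1 *\<^sub>R b) - (f 0 - 0 *\<^sub>R b)) \<le> C * norm (1 - 0 :: real)"
  proof (rule differentiable_bound[where S = "{0..1}" and f' = "\<lambda>t s. s *\<^sub>R (f' t - b)"])
    fix t :: real assume t: "t \<in> {0..1}"
    have "((\<lambda>t. f t - t *\<^sub>R b) has_vector_derivative f' t - b) (at t)"
      by (rule has_vector_derivative_diff[OF f[OF t]]) (auto intro!: derivative_eq_intros)
    then show "((\<lambda>t. f t - t *\<^sub>R b) has_derivative (\<lambda>s. s *\<^sub>R (f' t - b))) (at t within {0..1})"
      unfolding has_vector_derivative_def by (rule has_derivative_at_withinI)
    show "onorm (\<lambda>s. s *\<^sub>R (f' t - b)) \<le> C"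
      by (rule onorm_le) (use mult_left_mono[OF C[OF t] abs_ge_zero] in \<open>simp add: mult.commute\<close>)
  qed auto
  moreover have "(f 1 - 1 *\<^sub>R b) - (f 0 - 0 *\<^sub>R b) = f 1 - f 0 - b"
    by (simp add: algebra_simps)
  ultimately show ?thesis by (simp only: norm_one diff_zero mult_1_right)
qed

lemma mean_value_line:
  assumes "\<And>t. t \<in> {0..1} \<Longrightarrow> g differentiable (at (x + t *\<^sub>R h))"
    and "\<And>t. t \<in> {0..1} \<Longrightarrow> norm (dir_deriv g h (x + t *\<^sub>R h) - b) \<le> C"
  shows "norm (g (x + h) - g x - b) \<le> C"
  using mean_value_unit_interval[OF has_vector_derivative_line[OF assms(1)] assms(2)] by simp

lemma norm_Pair_mono: "norm a \<le> norm c \<Longrightarrow> norm b \<le> norm d \<Longrightarrow> norm (a, b) \<le> norm (c, d)"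
  by (simp add: norm_prod_def add_mono power_mono)

lemma norm_triple_le: "norm (a, b, c) \<le> norm a + norm b + norm c"
  using norm_Pair_le[of a "(b, c)"] norm_Pair_le[of b c] by simp

lemma norm_scaleR_le_unit: "t \<in> {0..1} \<Longrightarrow> norm (t *\<^sub>R v) \<le> norm v"
  by (simp add: mult_left_le_one_le)

text \<open>What is left of the groupoid near the units once \<open>u\<close> is treated as a
  parameter: a smooth family of products with \<open>0\<close> as two-sided unit.\<close>

locale local_product =
  fixes S :: "('u::finite_dim_inner \<times> 'v::finite_dim_inner \<times> 'v) set" and P :: "'u \<times> 'v \<times> 'v \<Rightarrow> 'v"
  assumes open_S: "open S" and smooth: "smooth_on S P"
    and unit_right: "(u, v, 0) \<in> S \<Longrightarrow> P (u, v, 0) = v"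
    and unit_left: "(u, 0, w) \<in> S \<Longrightarrow> P (u, 0, w) = w"
begin

definition mixed :: "'u \<Rightarrow> 'v \<Rightarrow> 'v \<Rightarrow> 'v" where
  "mixed u v w = dir_deriv (dir_deriv P (0, 0, w)) (0, v, 0) (u, 0, 0)"

lemma Ck: "Ck_on k P S"
  using smooth by (simp add: smooth_on_def)

text \<open>Linearity in \<open>v\<close> is that of the outer derivative in its direction;
  linearity in \<open>w\<close>, the inner direction, is \<open>linear_dir_deriv2\<close>. Both are
  composed with the embeddings of \<open>'v\<close> as a factor.\<close>

lemma bilinear_mixed:
  assumes "(u, 0, 0) \<in> S"
  shows "bilinear (mixed u)"
proof -
  have a: "linear (\<lambda>w. (0::'u, 0::'v, w::'v))" and b: "linear (\<lambda>v. (0::'u, v::'v, 0::'v))"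
    by (rule linearI; simp)+
  show ?thesis
    unfolding bilinear_def mixed_def
    using linear_compose[OF a linear_dir_deriv2[OF open_S assms Ck]]
      linear_compose[OF b linear_dir_deriv[OF Ck_on_dir_deriv[OF Ck] assms]]
    by (simp add: comp_def)
qed

text \<open>On the line \<open>t \<mapsto> (u, 0, t w)\<close> the left unit law makes
  \<open>P\<close> equal to \<open>t w\<close> for small \<open>t\<close>. This identity derivative
  is the starting point of the contraction estimate.\<close>

lemma dir_deriv_unit_left:
  assumes "(u, 0, 0) \<in> S"
  shows "dir_deriv P (0, 0, w) (u, 0, 0) = w"
proof -
  let ?l = "\<lambda>t. (u, 0, 0) + t *\<^sub>R (0, 0, w)"
  have "P differentiable (at (?l 0))" using Ck_on_differentiable[OF Ck assms] by simp
  from has_vector_derivative_line[OF this]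
  have 1: "((\<lambda>t. P (?l t)) has_vector_derivative dir_deriv P (0, 0, w) (u, 0, 0)) (at 0)" by simp
  have o: "open (?l -` S)"
    by (rule open_vimage[OF open_S]) (intro continuous_intros)
  have z: "0 \<in> ?l -` S" using assms by simp
  have d: "((\<lambda>t. t *\<^sub>R w) has_vector_derivative w) (at 0)"
    unfolding has_vector_derivative_def
    by (rule bounded_linear_imp_has_derivative[OF bounded_linear_scaleR_left])
  have "t *\<^sub>R w = P (?l t)" if "t \<in> ?l -` S" for t
    using that by (simp add: unit_left)
  from has_vector_derivative_transform_within_open[OF d o z this]
  have "((\<lambda>t. P (?l t)) has_vector_derivative w) (at 0)" .
  with 1 show ?thesis by (rule vector_derivative_unique_at)
qed

text \<open>
  The remainder bound comes from the second difference
  \<open>(P (u, v, w) - P (u, 0, w)) - (P (u, v, 0) - P (u, 0, 0))\<close>: both pure terms are known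
  exactly, so only the mixed derivative enters.
\<close>

lemma local_estimates:
  assumes x0: "(u\<^sub>0, 0, 0) \<in> S"
  obtains R M where "0 < R" "0 \<le> M"
    "\<And>u v w. dist u u\<^sub>0 < R \<Longrightarrow> norm v < R \<Longrightarrow> norm w < R \<Longrightarrow> (u, v, w) \<in> S"
    "\<And>u v w. dist u u\<^sub>0 < R \<Longrightarrow> norm v < R \<Longrightarrow> norm w < R \<Longrightarrow>
      norm (P (u, v, w) - v - w - mixed u v w) \<le> M * norm (v, w) ^ 3"
    "\<And>u v w. dist u u\<^sub>0 < R \<Longrightarrow> norm (mixed u v w) \<le> M * norm v * norm w"
    "\<And>u v w w'. dist u u\<^sub>0 < R \<Longrightarrow> norm v < R \<Longrightarrow> norm w < R \<Longrightarrow> norm w' < R \<Longrightarrow>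
      norm (P (u, v, w) - P (u, v, w') - (w - w')) \<le> norm (w - w') / 2"
proof -
  let ?x0 = "(u\<^sub>0, 0::'v, 0::'v)"
  obtain M2 where M2: "\<forall>\<^sub>F y in nhds ?x0. \<forall>h k. norm (dir_deriv (dir_deriv P k) h y) \<le> M2 * norm h * norm k"
    using eventually_second_deriv_bound[OF open_S x0 Ck] by blast
  obtain M3 where M3: "\<forall>\<^sub>F y in nhds ?x0. \<forall>h k l.
    norm (dir_deriv (dir_deriv (dir_deriv P l) k) h y) \<le> M3 * norm h * norm k * norm l"
    using eventually_third_deriv_bound[OF open_S x0 Ck] by blast
  have "\<forall>\<^sub>F y in nhds ?x0. y \<in> S"
    using open_S x0 by (rule eventually_nhds_in_open)
  with M2 M3 have "\<forall>\<^sub>F y in nhds ?x0. y \<in> S \<and>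
      (\<forall>h k. norm (dir_deriv (dir_deriv P k) h y) \<le> M2 * norm h * norm k) \<and>
      (\<forall>h k l. norm (dir_deriv (dir_deriv (dir_deriv P l) k) h y) \<le> M3 * norm h * norm k * norm l)"
    by eventually_elim blast
  then obtain d where d: "0 < d" and near: "\<And>y. dist y ?x0 < d \<Longrightarrow> y \<in> S \<and>
      (\<forall>h k. norm (dir_deriv (dir_deriv P k) h y) \<le> M2 * norm h * norm k) \<and>
      (\<forall>h k l. norm (dir_deriv (dir_deriv (dir_deriv P l) k) h y) \<le> M3 * norm h * norm k * norm l)"
    unfolding eventually_nhds_metric by blast
  define M where "M = max 1 (max M2 M3)"
  have M: "M2 \<le> M" "M3 \<le> M" "1 \<le> M" by (auto simp: M_def)
  \<comment> \<open>The factor \<open>1 / 3\<close> pays for adding up the norms of three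
    coordinates; \<open>1 / (6 * M)\<close> brings \<open>M * (3 * R)\<close>, second derivative
    times distance, below the contraction constant \<open>1 / 2\<close>. The \<open>1\<close> in
    \<open>M\<close> keeps the denominator positive.\<close>
  define R where "R = min (d / 3) (1 / (6 * M))"
  have R: "0 < R" "3 * R \<le> d" using d M by (auto simp: R_def)
  have MR: "M * (3 * R) \<le> 1 / 2"
  proof -
    have "R \<le> 1 / (6 * M)" by (simp add: R_def)
    then show ?thesis using M by (simp add: field_simps)
  qed
  have dist3: "dist (u, v, w) ?x0 < 3 * R" if "dist u u\<^sub>0 < R" "norm v < R" "norm w < R" for u v w
    using norm_triple_le[of "u - u\<^sub>0" v w] that by (simp add: dist_norm)
  have inS: "(u, v, w) \<in> S"
    and bd2: "norm (dir_deriv (dir_deriv P k) h (u, v, w)) \<le> M * norm h * norm k"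
    and bd3: "norm (dir_deriv (dir_deriv (dir_deriv P l) k) h (u, v, w)) \<le> M * norm h * norm k * norm l"
    if box: "dist u u\<^sub>0 < R" "norm v < R" "norm w < R" for u v w h k l
  proof -
    have n: "dist (u, v, w) ?x0 < d" using dist3[OF box] R by simp
    show "(u, v, w) \<in> S" using near[OF n] by blast
    have "norm (dir_deriv (dir_deriv P k) h (u, v, w)) \<le> M2 * norm h * norm k"
      using near[OF n] by blast
    also have "\<dots> \<le> M * norm h * norm k" using M by (intro mult_right_mono) auto
    finally show "norm (dir_deriv (dir_deriv P k) h (u, v, w)) \<le> M * norm h * norm k" .
    have "norm (dir_deriv (dir_deriv (dir_deriv P l) k) h (u, v, w)) \<le> M3 * norm h * norm k * norm l"
      using near[OF n] by blast
    also have "\<dots> \<le> M * norm h * norm k * norm l" using M by (intro mult_right_mono) auto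
    finally show "norm (dir_deriv (dir_deriv (dir_deriv P l) k) h (u, v, w)) \<le> M * norm h * norm k * norm l" .
  qed
  have scale: "norm (t *\<^sub>R v) < R" if "norm v < R" "t \<in> {0..1}" for t and v :: 'v
    using norm_scaleR_le_unit[OF that(2), of v] that(1) by simp
  have taylor: "norm (P (u, v, w) - v - w - mixed u v w) \<le> M * norm (v, w) ^ 3"
    if u: "dist u u\<^sub>0 < R" and v: "norm v < R" and w: "norm w < R" for u v w
  proof -
    let ?n = "norm (v, w)" and ?Pw = "dir_deriv P (0, 0, w)"
    let ?Pvw = "dir_deriv ?Pw (0, v, 0)"
    have n: "norm v \<le> ?n" "norm w \<le> ?n" by (simp_all add: norm_fst_le norm_snd_le)
    \<comment> \<open>The third derivative is taken in the directions \<open>w\<close>,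
      \<open>v\<close> and the displacement \<open>?h\<close>, each of norm at most
      \<open>?n\<close>; hence the cube.\<close>
    have C: "norm (?Pvw (u, s *\<^sub>R v, t *\<^sub>R w) - mixed u v w) \<le> M * ?n ^ 3"
      if s: "s \<in> {0..1}" and t: "t \<in> {0..1}" for s t
    proof -
      let ?h = "(0::'u, s *\<^sub>R v, t *\<^sub>R w)"
      have "norm (?Pvw ((u, 0, 0) + ?h) - ?Pvw (u, 0, 0) - 0) \<le> M * ?n ^ 3"
      proof (rule mean_value_line)
        fix \<tau> :: real assume \<tau>: "\<tau> \<in> {0..1}"
        have eq: "(u, 0, 0) + \<tau> *\<^sub>R ?h = (u, \<tau> *\<^sub>R s *\<^sub>R v, \<tau> *\<^sub>R t *\<^sub>R w)" by simp
        have box: "norm (\<tau> *\<^sub>R s *\<^sub>R v) < R" "norm (\<tau> *\<^sub>R t *\<^sub>R w) < R"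
          using scale v w s t \<tau> by blast+
        show "?Pvw differentiable (at ((u, 0, 0) + \<tau> *\<^sub>R ?h))"
          unfolding eq
          by (rule Ck_on_differentiable[OF Ck_on_dir_deriv[OF Ck_on_dir_deriv[OF Ck]] inS[OF u box]])
        have h: "norm ?h \<le> ?n"
          using norm_Pair_mono[OF norm_scaleR_le_unit[OF s, of v] norm_scaleR_le_unit[OF t, of w]]
          by (simp add: norm_Pair)
        have "norm (dir_deriv ?Pvw ?h (u, \<tau> *\<^sub>R s *\<^sub>R v, \<tau> *\<^sub>R t *\<^sub>R w))
            \<le> M * norm ?h * norm (0::'u, v, 0::'v) * norm (0::'u, 0::'v, w)"
          by (rule bd3[OF u box])
        also have "\<dots> \<le> M * ?n * ?n * ?n"
          using n h M by (intro mult_mono) (auto simp: norm_Pair)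
        finally show "norm (dir_deriv ?Pvw ?h ((u, 0, 0) + \<tau> *\<^sub>R ?h) - 0) \<le> M * ?n ^ 3"
          unfolding eq by (simp add: power3_eq_cube mult.assoc)
      qed
      then show ?thesis by (simp add: mixed_def)
    qed
    have B: "norm (?Pw (u, v, t *\<^sub>R w) - ?Pw (u, 0, t *\<^sub>R w) - mixed u v w) \<le> M * ?n ^ 3"
      if t: "t \<in> {0..1}" for t
    proof -
      have "norm (?Pw ((u, 0, t *\<^sub>R w) + (0, v, 0)) - ?Pw (u, 0, t *\<^sub>R w) - mixed u v w) \<le> M * ?n ^ 3"
      proof (rule mean_value_line)
        fix s :: real assume s: "s \<in> {0..1}"
        have eq: "(u, 0, t *\<^sub>R w) + s *\<^sub>R (0, v, 0) = (u, s *\<^sub>R v, t *\<^sub>R w)" by simp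
        show "?Pw differentiable (at ((u, 0, t *\<^sub>R w) + s *\<^sub>R (0, v, 0)))"
          unfolding eq
          by (rule Ck_on_differentiable[OF Ck_on_dir_deriv[OF Ck] inS[OF u scale[OF v s] scale[OF w t]]])
        show "norm (?Pvw ((u, 0, t *\<^sub>R w) + s *\<^sub>R (0, v, 0)) - mixed u v w) \<le> M * ?n ^ 3"
          unfolding eq by (rule C[OF s t])
      qed
      then show ?thesis by simp
    qed
    \<comment> \<open>\<open>?k 1 - ?k 0\<close> is the second difference. The derivative of
      \<open>?k\<close> is the increment of \<open>?Pw\<close> from \<open>0\<close> to
      \<open>v\<close>, which is what \<open>B\<close> controls.\<close>
    let ?k = "\<lambda>t. P ((u, v, 0) + t *\<^sub>R (0, 0, w)) - P ((u, 0, 0) + t *\<^sub>R (0, 0, w))"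
    have "norm (?k 1 - ?k 0 - mixed u v w) \<le> M * ?n ^ 3"
    proof (rule mean_value_unit_interval)
      fix t :: real assume t: "t \<in> {0..1}"
      have eq: "(u, v', 0) + t *\<^sub>R (0, 0, w) = (u, v', t *\<^sub>R w)" for v' :: 'v by simp
      have z: "norm (0::'v) < R" using R by simp
      have diff: "P differentiable (at ((u, v', 0) + t *\<^sub>R (0, 0, w)))" if "norm v' < R" for v'
        unfolding eq by (rule Ck_on_differentiable[OF Ck inS[OF u that scale[OF w t]]])
      show "(?k has_vector_derivative
          ?Pw ((u, v, 0) + t *\<^sub>R (0, 0, w)) - ?Pw ((u, 0, 0) + t *\<^sub>R (0, 0, w))) (at t)"
        by (intro has_vector_derivative_diff has_vector_derivative_line diff v z)
      show "norm (?Pw ((u, v, 0) + t *\<^sub>R (0, 0, w)) - ?Pw ((u, 0, 0) + t *\<^sub>R (0, 0, w)) - mixed u v w)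
          \<le> M * ?n ^ 3"
        unfolding eq by (rule B[OF t])
    qed
    moreover have "?k 1 - ?k 0 = P (u, v, w) - v - w"
    proof -
      have "norm (0::'v) < R" using R by simp
      then show ?thesis
        using unit_right[OF inS[OF u v]] unit_left[OF inS[OF u _ w]] unit_left[OF inS[OF u]] by simp
    qed
    ultimately show ?thesis by (simp only:)
  qed
  have mixed_bd: "norm (mixed u v w) \<le> M * norm v * norm w" if u: "dist u u\<^sub>0 < R" for u v w
    using bd2[OF u, of 0 0 "(0, 0, w)" "(0, v, 0)"] R by (simp add: mixed_def norm_Pair)
  have contr: "norm (P (u, v, w) - P (u, v, w') - (w - w')) \<le> norm (w - w') / 2"
    if u: "dist u u\<^sub>0 < R" and v: "norm v < R" and w: "norm w < R" and w': "norm w' < R" for u v w w'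
  proof -
    let ?h = "(0::'u, 0::'v, w - w')"
    have "norm (P ((u, v, w') + ?h) - P (u, v, w') - (w - w')) \<le> norm (w - w') / 2"
    proof (rule mean_value_line)
      fix t :: real assume t: "t \<in> {0..1}"
      let ?z = "w' + t *\<^sub>R (w - w')"
      have eq: "(u, v, w') + t *\<^sub>R ?h = (u, v, ?z)" by simp
      have "?z = (1 - t) *\<^sub>R w' + t *\<^sub>R w" by (simp add: algebra_simps)
      then have "?z \<in> ball 0 R"
        using convexD_alt[OF convex_ball, of w' 0 R w t] w w' t by simp
      then have z: "norm ?z < R" by simp
      show "P differentiable (at ((u, v, w') + t *\<^sub>R ?h))"
        unfolding eq by (rule Ck_on_differentiable[OF Ck inS[OF u v z]])
      let ?g = "dir_deriv P ?h"
      let ?k = "(u - u\<^sub>0, v, ?z)"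
      have k: "norm ?k \<le> 3 * R" using dist3[OF u v z] by (simp add: dist_norm)
      \<comment> \<open>At the base point \<open>?g\<close> equals \<open>w - w'\<close> by
        \<open>dir_deriv_unit_left\<close>; a displacement of norm at most \<open>3 * R\<close>
        changes it by at most \<open>M * (3 * R)\<close> times the norm of
        \<open>w - w'\<close>.\<close>
      have "norm (?g (?x0 + ?k) - ?g ?x0 - 0) \<le> norm (w - w') / 2"
      proof (rule mean_value_line)
        fix s :: real assume s: "s \<in> {0..1}"
        let ?y = "(u\<^sub>0 + s *\<^sub>R (u - u\<^sub>0), s *\<^sub>R v, s *\<^sub>R ?z)"
        have eq: "?x0 + s *\<^sub>R ?k = ?y" by simp
        have du: "dist (u\<^sub>0 + s *\<^sub>R (u - u\<^sub>0)) u\<^sub>0 < R"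
          using norm_scaleR_le_unit[OF s, of "u - u\<^sub>0"] u by (simp add: dist_norm)
        show "?g differentiable (at (?x0 + s *\<^sub>R ?k))"
          unfolding eq
          by (rule Ck_on_differentiable[OF Ck_on_dir_deriv[OF Ck] inS[OF du scale[OF v s] scale[OF z s]]])
        have "norm (dir_deriv ?g ?k ?y) \<le> M * norm ?k * norm ?h"
          by (rule bd2[OF du scale[OF v s] scale[OF z s]])
        also have "\<dots> \<le> M * (3 * R) * norm ?h"
          using k M by (intro mult_right_mono mult_left_mono) auto
        also have "\<dots> \<le> 1 / 2 * norm ?h"
          using MR by (intro mult_right_mono) auto
        finally show "norm (dir_deriv ?g ?k (?x0 + s *\<^sub>R ?k) - 0) \<le> norm (w - w') / 2"
          unfolding eq by (simp add: norm_Pair)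
      qed
      then show "norm (dir_deriv P ?h ((u, v, w') + t *\<^sub>R ?h) - (w - w')) \<le> norm (w - w') / 2"
        unfolding eq by (simp add: dir_deriv_unit_left[OF x0])
    qed
    then show ?thesis by simp
  qed
  show ?thesis
    by (rule that[OF R(1) _ inS taylor mixed_bd contr]) (use M in auto)
qed

text \<open>
  The solution \<open>w\<close> of \<open>P (u, v, w) = 0\<close> is the fixed point of \<open>w \<mapsto> w - P (u, v, w)\<close>, a
  contraction near \<open>0\<close>; inserting \<open>w = - v + O(\<bar>v\<bar>\<^sup>2)\<close> into the expansion of \<open>P\<close> gives the
  second-order term.
\<close>

lemma local_inverse:
  assumes x0: "(u\<^sub>0, 0, 0) \<in> S"
  obtains r K where "0 < r"
    "\<And>u v. dist u u\<^sub>0 < r \<Longrightarrow> norm v < r \<Longrightarrow>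
      \<exists>w. (u, v, w) \<in> S \<and> P (u, v, w) = 0 \<and> norm (w + v - mixed u v v) \<le> K * norm v ^ 3"
proof (rule local_estimates[OF x0])
  fix R M
  assume R: "0 < R" and M: "0 \<le> M" and
    inS: "\<And>u v w. dist u u\<^sub>0 < R \<Longrightarrow> norm v < R \<Longrightarrow> norm w < R \<Longrightarrow> (u, v, w) \<in> S" and
    taylor: "\<And>u v w. dist u u\<^sub>0 < R \<Longrightarrow> norm v < R \<Longrightarrow> norm w < R \<Longrightarrow>
      norm (P (u, v, w) - v - w - mixed u v w) \<le> M * norm (v, w) ^ 3" and
    mixed: "\<And>u v w. dist u u\<^sub>0 < R \<Longrightarrow> norm (mixed u v w) \<le> M * norm v * norm w" and
    contr: "\<And>u v w w'. dist u u\<^sub>0 < R \<Longrightarrow> norm v < R \<Longrightarrow> norm w < R \<Longrightarrow> norm w' < R \<Longrightarrow>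
      norm (P (u, v, w) - P (u, v, w') - (w - w')) \<le> norm (w - w') / 2"
  \<comment> \<open>The \<open>27\<close> is the cube in
    \<open>norm (v, w) \<le> 3 * norm v\<close>, the \<open>2 * M\<close> comes from
    \<open>norm w \<le> 2 * norm v\<close>, and the factor \<open>R\<close> from trading a cube of
    \<open>norm v\<close> for a square. The first summand bounds \<open>mixed u v (w + v)\<close>,
    the second the Taylor remainder.\<close>
  define K where "K = M * (2 * M + 27 * M * R) + 27 * M"
  have "\<exists>w. (u, v, w) \<in> S \<and> P (u, v, w) = 0 \<and> norm (w + v - mixed u v v) \<le> K * norm v ^ 3"
    \<comment> \<open>With radius \<open>R / 4\<close> the bound \<open>norm w / 2 + norm v\<close>
      is at most \<open>R / 2\<close>, so \<open>?T\<close> maps the closed ball of radius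
      \<open>R / 2\<close> into itself.\<close>
    if u: "dist u u\<^sub>0 < R / 4" and v: "norm v < R / 4" for u v
  proof -
    have u': "dist u u\<^sub>0 < R" and v': "norm v < R" using u v R by auto
    let ?T = "\<lambda>w. w - P (u, v, w)"
    have T: "norm (?T w - ?T w') \<le> norm (w - w') / 2" if "norm w < R" "norm w' < R" for w w'
      using contr[OF u' v' that] norm_minus_commute[of "P (u, v, w) - P (u, v, w')" "w - w'"]
      by (simp add: algebra_simps)
    have z: "norm (0::'v) < R" using R by simp
    have T0: "?T 0 = - v" using unit_right[OF inS[OF u' v' z]] by simp
    have Tn: "norm (?T w) \<le> norm w / 2 + norm v" if "norm w < R" for w
    proof -
      have "norm (?T w) \<le> norm (?T w - ?T 0) + norm (?T 0)" by (metis diff_add_cancel norm_triangle_ineq)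
      also have "\<dots> \<le> norm w / 2 + norm v" using T[OF that z] T0 by simp
      finally show ?thesis .
    qed
    have "\<exists>!w. w \<in> cball 0 (R / 2) \<and> ?T w = w"
    proof (rule Banach_fix[of "cball 0 (R / 2)" "1 / 2"])
      show "complete (cball (0::'v) (R / 2))"
        using complete_Int_closed[OF complete_UNIV_finite_dim closed_cball] by simp
      show "cball (0::'v) (R / 2) \<noteq> {}" using R by simp
      show "?T ` cball 0 (R / 2) \<subseteq> cball 0 (R / 2)"
      proof (rule image_subsetI)
        fix w assume "w \<in> cball (0::'v) (R / 2)"
        then have w: "norm w \<le> R / 2" by simp
        then have "norm (?T w) \<le> norm w / 2 + norm v" using R by (intro Tn) simp
        then show "?T w \<in> cball 0 (R / 2)" using w v by simp
      qed
      show "dist (?T w) (?T w') \<le> 1 / 2 * dist w w'"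
        if "w \<in> cball 0 (R / 2)" "w' \<in> cball 0 (R / 2)" for w w'
        using T[of w w'] that R by (simp add: dist_norm)
    qed simp_all
    then obtain w where w: "norm w \<le> R / 2" "?T w = w" by auto
    have w': "norm w < R" using w R by simp
    have P0: "P (u, v, w) = 0" using w(2) by simp
    have w2: "norm w \<le> 2 * norm v" using Tn[OF w'] w(2) by simp
    let ?n = "norm v"
    have n3: "norm (v, w) \<le> 3 * ?n" using norm_Pair_le[of v w] w2 by simp
    have O: "norm (v + w + mixed u v w) \<le> 27 * M * ?n ^ 3"
    proof -
      have "norm (v + w + mixed u v w) = norm (P (u, v, w) - v - w - mixed u v w)"
        unfolding P0 by (metis (no_types) diff_diff_eq diff_0 norm_minus_cancel)
      also have "\<dots> \<le> M * norm (v, w) ^ 3" by (rule taylor[OF u' v' w'])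
      also have "\<dots> \<le> M * (3 * ?n) ^ 3" using n3 M by (intro mult_left_mono power_mono) auto
      finally show ?thesis by (simp add: power3_eq_cube)
    qed
    have cube: "?n ^ 3 \<le> R * ?n ^ 2"
      using mult_right_mono[of ?n R "?n ^ 2"] v' by (simp add: power3_eq_cube power2_eq_square mult.assoc)
    \<comment> \<open>First pass, to second order only; fed back into the bilinear term below, it
      gains the missing factor \<open>norm v\<close>.\<close>
    have wv: "norm (w + v) \<le> (2 * M + 27 * M * R) * ?n ^ 2"
    proof -
      have "norm (w + v) = norm ((v + w + mixed u v w) - mixed u v w)" by (simp add: add.commute)
      also have "\<dots> \<le> 27 * M * ?n ^ 3 + M * ?n * norm w"
        by (rule order_trans[OF norm_triangle_ineq4 add_mono[OF O mixed[OF u']]])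
      also have "\<dots> \<le> 27 * M * (R * ?n ^ 2) + M * ?n * (2 * ?n)"
        using M w2 cube by (intro add_mono mult_left_mono) auto
      finally show ?thesis by (simp add: power2_eq_square algebra_simps)
    qed
    have S0: "(u, 0, 0) \<in> S" using inS[OF u' z z] .
    \<comment> \<open>Replaces \<open>w\<close> by \<open>- v\<close> inside the bilinear term at
      the cost of \<open>mixed u v (w + v)\<close>, which is of third order by
      \<open>wv\<close>.\<close>
    have "mixed u v (w + v) = mixed u v w + mixed u v v"
      by (rule bilinear_radd[OF bilinear_mixed[OF S0]])
    then have "norm (w + v - mixed u v v) = norm ((v + w + mixed u v w) - mixed u v (w + v))"
      by (simp add: algebra_simps)
    also have "\<dots> \<le> 27 * M * ?n ^ 3 + M * ?n * norm (w + v)"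
      by (rule order_trans[OF norm_triangle_ineq4 add_mono[OF O mixed[OF u']]])
    also have "\<dots> \<le> 27 * M * ?n ^ 3 + M * ?n * ((2 * M + 27 * M * R) * ?n ^ 2)"
      using wv M by (intro add_left_mono mult_left_mono) auto
    also have "\<dots> = K * ?n ^ 3"
      by (simp add: K_def power2_eq_square power3_eq_cube algebra_simps)
    finally show ?thesis using inS[OF u' v' w'] P0 by blast
  qed
  then show ?thesis using that[of "R / 4" K] R by simp
qed

end


section \<open>Lie groupoids in adapted charts\<close>

context groupoid
begin

lemma unit_arrows: "x \<in> units G \<Longrightarrow> x \<in> arrows G"
  using prod_closed[OF composable_inv] by (auto simp: units_def rng_def)

text \<open>The pair of \<open>inv_of G g\<close> and \<open>prod_of G g h\<close> is composable,
  and \<open>composable_iff\<close> reads this as an equality of source and range.\<close>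

lemma rng_prod:
  assumes "(g, h) \<in> composable G"
  shows "rng G (prod_of G g h) = rng G g"
proof -
  have g: "g \<in> arrows G" using assms composable_subset by auto
  have "(inv_of G g, prod_of G g h) \<in> composable G"
    using assoc[OF inv_composable[OF g] assms] by blast
  then have "src G (inv_of G g) = rng G (prod_of G g h)"
    using composable_iff[OF inv_closed[OF g] prod_closed[OF assms]] by blast
  then show ?thesis using src_inv[OF g] by simp
qed

lemma rng_unit: "x \<in> units G \<Longrightarrow> rng G x = x"
  using rng_prod[OF composable_inv] by (auto simp: units_def rng_def)

lemma prod_rng:
  assumes "h \<in> arrows G"
  shows "prod_of G (rng G h) h = h"
  using inv_cancel_right[OF composable_inv[OF assms]] inv_inv[OF assms] by (simp add: rng_def)

lemma prod_src:
  assumes "g \<in> arrows G"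
  shows "prod_of G g (src G g) = g"
  using inv_cancel_left[OF inv_composable[OF assms]] inv_inv[OF assms] by (simp add: src_def)

lemma src_prod:
  assumes "(g, h) \<in> composable G"
  shows "src G (prod_of G g h) = src G h"
proof -
  have h: "h \<in> arrows G" using assms composable_subset by auto
  have "(prod_of G g h, inv_of G h) \<in> composable G"
    using assoc[OF assms composable_inv[OF h]] by blast
  then have "src G (prod_of G g h) = rng G (inv_of G h)"
    using composable_iff[OF prod_closed[OF assms] inv_closed[OF h]] by blast
  then show ?thesis using rng_inv[OF h] by simp
qed

lemma src_unit: "x \<in> units G \<Longrightarrow> src G x = x"
  using src_prod[OF inv_composable] by (auto simp: units_eq_src src_def)

text \<open>Cancel \<open>g\<close> on the left in \<open>g h = g g^{-1}\<close>.\<close>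

lemma inv_of_eqI:
  assumes "(g, h) \<in> composable G" "prod_of G g h = rng G g"
  shows "inv_of G g = h"
proof -
  have g: "g \<in> arrows G" using assms(1) composable_subset by auto
  have "prod_of G (inv_of G g) (prod_of G g h) = h" by (rule inv_cancel_left[OF assms(1)])
  moreover have "prod_of G (inv_of G g) (prod_of G g (inv_of G g)) = inv_of G g"
    by (rule inv_cancel_left[OF composable_inv[OF g]])
  ultimately show ?thesis using assms(2) unfolding rng_def by metis
qed

end

section \<open>Units, composability and the source map in the chart\<close>

locale adapted_lie_groupoid =
  fixes G :: "'g groupoid_data" and X :: "'g topology"
    and A :: "('g, 'u::finite_dim_inner \<times> 'v::finite_dim_inner) chart set" and x\<^sub>0 :: 'g
    and U :: "'u set" and V :: "'v set"
    and \<psi> :: "'u \<times> 'v \<Rightarrow> 'g" and \<phi> :: "'u \<Rightarrow> 'g" and \<sigma> :: "'u \<times> 'v \<Rightarrow> 'u"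
  assumes lie: "lie_groupoid G X A"
    and adapted: "adapted_charts G X A x\<^sub>0 U V \<psi> \<phi>"
    and src_chart: "\<forall>u\<in>U. \<forall>v\<in>V. src G (\<psi> (u, v)) \<in> \<phi> ` U"
    and sigma_eq: "\<sigma> = inv_into U \<phi> \<circ> src G \<circ> \<psi>"
begin

sublocale groupoid G
  using lie by (simp add: lie_groupoid_def)

lemma manifold: "smooth_manifold X A" and topspace_X: "topspace X = arrows G"
  and smooth_prod: "smooth_map (product_atlas A A) (composable G) A (\<lambda>(g, h). prod_of G g h)"
  and smooth_src_slice: "smooth_map A (arrows G) (slice_charts X A (units G)) (src G)"
  using lie by (simp_all add: lie_groupoid_def submersion_def)

lemma open_U: "open U" and open_V: "open V" and zero_V: "0 \<in> V"
  and rng_psi: "u \<in> U \<Longrightarrow> v \<in> V \<Longrightarrow> rng G (\<psi> (u, v)) = \<phi> u"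
  and psi_units: "\<psi> ` (U \<times> {0}) = \<psi> ` (U \<times> V) \<inter> units G"
  and openin_psi: "openin X (\<psi> ` (U \<times> V))"
  and diffeo_psi: "diffeomorphism flat_atlas (U \<times> V) A (\<psi> ` (U \<times> V)) \<psi>"
  and inj_phi: "inj_on \<phi> U"
  using adapted unfolding adapted_charts_def parametrization_def diffeomorphism_def bij_betw_def
  by simp_all

lemma open_UV: "open (U \<times> V)" and open_UVV: "open (U \<times> V \<times> V)"
  by (simp_all add: open_Times open_U open_V)

lemma inj_psi: "inj_on \<psi> (U \<times> V)"
  and smooth_map_psi: "smooth_map flat_atlas (U \<times> V) A \<psi>"
  and smooth_map_inv_psi: "smooth_map A (\<psi> ` (U \<times> V)) flat_atlas (inv_into (U \<times> V) \<psi>)"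
  using diffeo_psi by (simp_all add: diffeomorphism_def bij_betw_def)

lemma psi_arrow: "u \<in> U \<Longrightarrow> v \<in> V \<Longrightarrow> \<psi> (u, v) \<in> arrows G"
  using openin_subset[OF openin_psi] topspace_X by auto

lemma inv_psi: "u \<in> U \<Longrightarrow> v \<in> V \<Longrightarrow> inv_into (U \<times> V) \<psi> (\<psi> (u, v)) = (u, v)"
  by (rule inv_into_f_f[OF inj_psi]) simp

lemma psi_zero_unit: "u \<in> U \<Longrightarrow> \<psi> (u, 0) \<in> units G"
  using psi_units by blast

text \<open>A unit is its own range, and the range of \<open>\<psi> (u, 0)\<close> is
  \<open>\<phi> u\<close>.\<close>

lemma psi_zero: "u \<in> U \<Longrightarrow> \<psi> (u, 0) = \<phi> u"
  using rng_unit[OF psi_zero_unit] rng_psi[OF _ zero_V] by metis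

lemma sigma_in: "u \<in> U \<Longrightarrow> v \<in> V \<Longrightarrow> \<sigma> (u, v) \<in> U"
  and src_psi: "u \<in> U \<Longrightarrow> v \<in> V \<Longrightarrow> src G (\<psi> (u, v)) = \<phi> (\<sigma> (u, v))"
  using src_chart by (simp_all add: sigma_eq inv_into_into f_inv_into_f)

lemma sigma_zero: "u \<in> U \<Longrightarrow> \<sigma> (u, 0) = u"
  using src_unit[OF psi_zero_unit] psi_zero inv_into_f_f[OF inj_phi] by (simp add: sigma_eq)

lemma composable_psi_iff:
  assumes "u \<in> U" "u\<^sub>1 \<in> U" "v \<in> V" "w \<in> V"
  shows "(\<psi> (u, v), \<psi> (u\<^sub>1, w)) \<in> composable G \<longleftrightarrow> u\<^sub>1 = \<sigma> (u, v)"
  using assms composable_iff[OF psi_arrow psi_arrow] rng_psi src_psi sigma_in inj_on_eq_iff[OF inj_phi]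
  by metis

lemma composable_psi:
  "u \<in> U \<Longrightarrow> v \<in> V \<Longrightarrow> w \<in> V \<Longrightarrow> (\<psi> (u, v), \<psi> (\<sigma> (u, v), w)) \<in> composable G"
  by (simp add: composable_psi_iff sigma_in)

lemma smooth_into_psi: "smooth_into A (U \<times> V) \<psi>"
  by (rule smooth_map_imp_smooth_into[OF manifold smooth_map_psi open_UV])

text \<open>
  As \<open>src (\<psi> (u, v)) = \<psi> (\<sigma> (u, v), 0)\<close>, the smoothness of \<open>\<sigma>\<close> can be read off in the chart
  \<open>\<psi>\<close> of the arrows, without comparing \<open>\<phi>\<close> with the slice charts.
\<close>

lemma smooth_sigma: "smooth_on (U \<times> V) \<sigma>"
proof -
  let ?q = "inv_into (U \<times> V) \<psi>"
  have units: "units G \<subseteq> topspace X" using unit_arrows topspace_X by auto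
  have "smooth_map flat_atlas (U \<times> V) A (\<lambda>x. src G (\<psi> x))"
    by (rule smooth_map_compose[OF smooth_into_psi
          smooth_map_slice_charts_ambient[OF manifold smooth_src_slice units]])
      (use psi_arrow in auto)
  then have into: "smooth_into A (U \<times> V) (\<lambda>x. src G (\<psi> x))"
    by (rule smooth_map_imp_smooth_into[OF manifold _ open_UV])
  have src: "src G (\<psi> x) = \<psi> (\<sigma> x, 0)" and \<sigma>: "\<sigma> x \<in> U" if "x \<in> U \<times> V" for x
    using that src_psi sigma_in psi_zero by auto
  have "smooth_map flat_atlas (U \<times> V) flat_atlas (\<lambda>x. ?q (src G (\<psi> x)))"
    by (rule smooth_map_compose[OF into smooth_map_inv_psi])
      (use src \<sigma> zero_V in \<open>simp add: image_subset_iff\<close>)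
  then have "smooth_on (U \<times> V) (\<lambda>x. ?q (src G (\<psi> x)))"
    by (rule smooth_map_flat_onD[OF _ open_UV])
  then have "smooth_on (U \<times> V) (\<lambda>x. fst (?q (src G (\<psi> x))))"
    by (rule smooth_on_linear_comp[OF bounded_linear_fst open_UV])
  then show ?thesis
    by (rule smooth_on_cong[OF open_UV, rotated]) (simp add: src \<sigma> zero_V inv_psi)
qed

section \<open>The product in the chart\<close>

definition mult :: "'u \<times> 'v \<times> 'v \<Rightarrow> 'g" where
  "mult x = prod_of G (\<psi> (fst x, fst (snd x))) (\<psi> (\<sigma> (fst x, fst (snd x)), snd (snd x)))"

text \<open>The pair of factors depends smoothly on the triple and is always composable, so the
  smoothness of the product on composable pairs can be pulled back to the open set
  \<open>U \<times> V \<times> V\<close>.\<close>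

lemma smooth_into_mult: "smooth_into A (U \<times> V \<times> V) mult"
proof -
  let ?S = "U \<times> V \<times> V"
  have fst_fst: "smooth_on ?S (\<lambda>x. (fst x, fst (snd x)))"
    by (intro smooth_on_linear[OF _ open_UVV] bounded_linear_intros)
  have sub: "(\<lambda>x. (fst x, fst (snd x))) ` ?S \<subseteq> U \<times> V" by auto
  have "smooth_on ?S (\<lambda>x. \<sigma> (fst x, fst (snd x)))"
    by (rule smooth_on_compose[OF open_UVV fst_fst smooth_sigma sub])
  moreover have "smooth_on ?S (\<lambda>x. snd (snd x))"
    by (intro smooth_on_linear[OF _ open_UVV] bounded_linear_intros)
  ultimately have *: "smooth_on ?S (\<lambda>x. (\<sigma> (fst x, fst (snd x)), snd (snd x)))"
    by (rule smooth_on_Pair[OF open_UVV])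
  have "smooth_into (product_atlas A A) ?S
      (\<lambda>x. (\<psi> (fst x, fst (snd x)), \<psi> (\<sigma> (fst x, fst (snd x)), snd (snd x))))"
    by (intro smooth_into_Pair smooth_into_compose_on[OF smooth_into_psi] fst_fst * sub open_UVV)
      (use sigma_in in auto)
  from smooth_map_compose[OF this smooth_prod]
  have "smooth_map flat_atlas ?S A mult"
    using composable_psi by (simp add: mult_def[abs_def] image_subset_iff)
  then show ?thesis by (rule smooth_map_imp_smooth_into[OF manifold _ open_UVV])
qed

abbreviation "pdom \<equiv> product_domain G U V \<psi> \<sigma>"

lemma pdom_eq: "pdom = {x \<in> U \<times> V \<times> V. mult x \<in> \<psi> ` (U \<times> V)}"
  by (auto simp: product_domain_def mult_def)

lemma open_pdom: "open pdom"
  unfolding pdom_eq by (rule smooth_into_open_vimage[OF manifold smooth_into_mult openin_psi])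

definition loc_prod :: "'u \<times> 'v \<times> 'v \<Rightarrow> 'v" where
  "loc_prod x = snd (inv_into (U \<times> V) \<psi> (mult x))"

lemma smooth_loc_prod: "smooth_on pdom loc_prod"
proof -
  have "smooth_into A pdom mult"
    by (rule smooth_into_subset[OF smooth_into_mult _ open_pdom]) (auto simp: pdom_eq)
  from smooth_map_compose[OF this smooth_map_inv_psi]
  have "smooth_map flat_atlas pdom flat_atlas (\<lambda>x. inv_into (U \<times> V) \<psi> (mult x))"
    by (simp add: pdom_eq image_subset_iff)
  then show ?thesis
    unfolding loc_prod_def[abs_def]
    by (intro smooth_on_linear_comp[OF bounded_linear_snd open_pdom] smooth_map_flat_onD[OF _ open_pdom])
qed

lemma pdom_D: "(u, v, w) \<in> pdom \<Longrightarrow> u \<in> U \<and> v \<in> V \<and> w \<in> V"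
  by (auto simp: pdom_eq)

text \<open>The product and its first factor have the same range, and \<open>\<phi>\<close> is
  injective, so the first coordinate of the product is \<open>u\<close>; this justifies keeping only
  the second one in \<open>loc_prod\<close>.\<close>

lemma mult_eq:
  assumes "(u, v, w) \<in> pdom"
  shows "loc_prod (u, v, w) \<in> V" "mult (u, v, w) = \<psi> (u, loc_prod (u, v, w))"
proof -
  have in_dom: "u \<in> U" "v \<in> V" "w \<in> V" using pdom_D[OF assms] by auto
  obtain u' v' where *: "u' \<in> U" "v' \<in> V" "mult (u, v, w) = \<psi> (u', v')"
    using assms by (auto simp: pdom_eq)
  have "\<phi> u' = rng G (mult (u, v, w))" using * rng_psi by simp
  also have "\<dots> = \<phi> u"
    using rng_prod[OF composable_psi[OF in_dom]] rng_psi in_dom by (simp add: mult_def)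
  finally have "u' = u" using inj_phi * in_dom by (auto dest: inj_onD)
  with * show "loc_prod (u, v, w) \<in> V" "mult (u, v, w) = \<psi> (u, loc_prod (u, v, w))"
    by (simp_all add: loc_prod_def inv_psi)
qed

lemma mult_unit_right: "u \<in> U \<Longrightarrow> v \<in> V \<Longrightarrow> mult (u, v, 0) = \<psi> (u, v)"
  using prod_src[OF psi_arrow] by (simp add: mult_def psi_zero sigma_in src_psi)

lemma mult_unit_left: "u \<in> U \<Longrightarrow> w \<in> V \<Longrightarrow> mult (u, 0, w) = \<psi> (u, w)"
  using prod_rng[OF psi_arrow] by (simp add: mult_def sigma_zero psi_zero rng_psi)

lemma zero_in_pdom: "u \<in> U \<Longrightarrow> (u, 0, 0) \<in> pdom"
  by (simp add: pdom_eq mult_unit_right zero_V)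

sublocale local_product pdom loc_prod
proof
  show "open pdom" by (rule open_pdom)
  show "smooth_on pdom loc_prod" by (rule smooth_loc_prod)
  show "loc_prod (u, v, 0) = v" if "(u, v, 0) \<in> pdom" for u v
    using pdom_D[OF that] by (simp add: loc_prod_def mult_unit_right inv_psi)
  show "loc_prod (u, 0, w) = w" if "(u, 0, w) \<in> pdom" for u w
    using pdom_D[OF that] by (simp add: loc_prod_def mult_unit_left inv_psi)
qed

section \<open>The inverse in the chart\<close>

definition loc_inv :: "'u \<Rightarrow> 'v \<Rightarrow> 'v" where
  "loc_inv u v = snd (inv_into (U \<times> V) \<psi> (inv_of G (\<psi> (u, v))))"

text \<open>The range of the inverse is the source of the arrow, which forces the first coordinate
  \<open>\<sigma> (u, v)\<close>. The product of the two is the unit \<open>\<psi> (u, 0)\<close>,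
  whose second coordinate is \<open>0\<close>.\<close>

lemma loc_inv_works:
  assumes "(u, v) \<in> inverse_domain G U V \<psi>"
  shows "loc_inv u v \<in> V" "inv_of G (\<psi> (u, v)) = \<psi> (\<sigma> (u, v), loc_inv u v)"
    "(u, v, loc_inv u v) \<in> pdom" "loc_prod (u, v, loc_inv u v) = 0"
proof -
  have uv: "u \<in> U" "v \<in> V" using assms by (auto simp: inverse_domain_def)
  obtain u' v' where *: "u' \<in> U" "v' \<in> V" "inv_of G (\<psi> (u, v)) = \<psi> (u', v')"
    using assms by (auto simp: inverse_domain_def)
  have "\<phi> u' = \<phi> (\<sigma> (u, v))"
    using rng_inv[OF psi_arrow[OF uv]] * rng_psi src_psi uv by simp
  then have "u' = \<sigma> (u, v)" using inj_phi * sigma_in[OF uv] by (auto dest: inj_onD)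
  with * show inV: "loc_inv u v \<in> V" and inv: "inv_of G (\<psi> (u, v)) = \<psi> (\<sigma> (u, v), loc_inv u v)"
    by (simp_all add: loc_inv_def inv_psi)
  have m: "mult (u, v, loc_inv u v) = \<psi> (u, 0)"
    using inv[symmetric] rng_psi[OF uv] psi_zero[OF uv(1)] by (simp add: mult_def rng_def)
  then show "(u, v, loc_inv u v) \<in> pdom" using uv inV zero_V by (simp add: pdom_eq)
  show "loc_prod (u, v, loc_inv u v) = 0" using m uv zero_V by (simp add: loc_prod_def inv_psi)
qed

text \<open>Identifies the small solution found by contraction with the coordinate of the true
  inverse: a product equal to the range of the first factor determines the second.\<close>

lemma loc_inv_unique:
  assumes "(u, v, w) \<in> pdom" "loc_prod (u, v, w) = 0"
  shows "loc_inv u v = w"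
proof -
  have in_dom: "u \<in> U" "v \<in> V" "w \<in> V" using pdom_D[OF assms(1)] by auto
  have "prod_of G (\<psi> (u, v)) (\<psi> (\<sigma> (u, v), w)) = rng G (\<psi> (u, v))"
    using mult_eq(2)[OF assms(1)] assms(2) psi_zero rng_psi in_dom by (simp add: mult_def)
  then have "inv_of G (\<psi> (u, v)) = \<psi> (\<sigma> (u, v), w)"
    by (rule inv_of_eqI[OF composable_psi[OF in_dom]])
  then show ?thesis using in_dom sigma_in by (simp add: loc_inv_def inv_psi)
qed

text \<open>The filter \<open>nhds\<close> on all three variables expresses uniformity in
  \<open>u\<close> near each \<open>u\<^sub>0\<close>. The product distance dominates each
  coordinate, so the ball of radius \<open>R\<close> lies in the box of
  \<open>local_estimates\<close>.\<close>

lemma product_remainder_bigo: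
  assumes "u\<^sub>0 \<in> U"
  shows "(\<lambda>(u, v, w). norm (loc_prod (u, v, w) - v - w - mixed u v w))
    \<in> O[nhds (u\<^sub>0, 0, 0)](\<lambda>(u, v, w). norm (v, w) ^ 3)"
proof (rule local_estimates[OF zero_in_pdom[OF assms]])
  fix R M
  assume R: "0 < R" and est: "\<And>u v w. dist u u\<^sub>0 < R \<Longrightarrow> norm v < R \<Longrightarrow> norm w < R \<Longrightarrow>
      norm (loc_prod (u, v, w) - v - w - mixed u v w) \<le> M * norm (v, w) ^ 3"
  have "norm (case x of (u, v, w) \<Rightarrow> norm (loc_prod (u, v, w) - v - w - mixed u v w))
      \<le> M * norm (case x of (u, v, w) \<Rightarrow> norm (v, w) ^ 3)"
    if x: "dist x (u\<^sub>0, 0, 0) < R" for x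
  proof -
    obtain u v w where [simp]: "x = (u, v, w)" by (cases x)
    have n: "norm (u - u\<^sub>0, v, w) < R" using x by (simp add: dist_norm)
    have "dist u u\<^sub>0 < R" "norm (v, w) < R"
      using n norm_fst_le[of "u - u\<^sub>0" "(v, w)"] norm_snd_le[of "(v, w)" "u - u\<^sub>0"]
      by (simp_all add: dist_norm)
    moreover from this(2) have "norm v < R" "norm w < R"
      using norm_fst_le[of v w] norm_snd_le[of w v] by simp_all
    ultimately show ?thesis using est by simp
  qed
  then show ?thesis
    using R by (intro bigoI[where c = M]) (auto simp: eventually_nhds_metric)
qed

text \<open>\<open>loc_inv_unique\<close> turns the solution provided by
  \<open>local_inverse\<close> into a bound on \<open>loc_inv\<close> over a full ball, which then
  restricts to \<open>inverse_domain\<close>.\<close>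

lemma inverse_remainder_bigo:
  assumes "u\<^sub>0 \<in> U"
  shows "(\<lambda>(u, v). norm (loc_inv u v + v - mixed u v v))
    \<in> O[inf (nhds (u\<^sub>0, 0)) (principal (inverse_domain G U V \<psi>))](\<lambda>(u, v). norm v ^ 3)"
proof (rule local_inverse[OF zero_in_pdom[OF assms]])
  fix r K
  assume r: "0 < r" and est: "\<And>u v. dist u u\<^sub>0 < r \<Longrightarrow> norm v < r \<Longrightarrow>
      \<exists>w. (u, v, w) \<in> pdom \<and> loc_prod (u, v, w) = 0 \<and> norm (w + v - mixed u v v) \<le> K * norm v ^ 3"
  have "norm (case x of (u, v) \<Rightarrow> norm (loc_inv u v + v - mixed u v v))
      \<le> K * norm (case x of (u, v) \<Rightarrow> norm v ^ 3)"
    if x: "dist x (u\<^sub>0, 0) < r" for x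
  proof -
    obtain u v where [simp]: "x = (u, v)" by (cases x)
    have n: "norm (u - u\<^sub>0, v) < r" using x by (simp add: dist_norm)
    have "dist u u\<^sub>0 < r" "norm v < r"
      using n norm_fst_le[of "u - u\<^sub>0" v] norm_snd_le[of v "u - u\<^sub>0"] by (simp_all add: dist_norm)
    from est[OF this] show ?thesis using loc_inv_unique by auto
  qed
  then show ?thesis
    using r by (intro bigoI[where c = K]) (auto simp: eventually_inf_principal eventually_nhds_metric)
qed

end

theorem proposition2p4:
  fixes G :: "'g groupoid_data"
    and X :: "'g topology"
    and A :: "('g, 'u::finite_dim_inner \<times> 'v::finite_dim_inner) chart set"
    and x\<^sub>0 :: 'g
    and U :: "'u set" and V :: "'v set"
    and \<psi> :: "'u \<times> 'v \<Rightarrow> 'g" and \<phi> :: "'u \<Rightarrow> 'g" and \<sigma> :: "'u \<times> 'v \<Rightarrow> 'u"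
  assumes "lie_groupoid G X A"
    and "x\<^sub>0 \<in> units G"
    and "adapted_charts G X A x\<^sub>0 U V \<psi> \<phi>"
    and "\<forall>u\<in>U. \<forall>v\<in>V. src G (\<psi> (u, v)) \<in> \<phi> ` U"
    and "\<sigma> = inv_into U \<phi> \<circ> src G \<circ> \<psi>"
  shows
    "(\<forall>u\<in>U. \<forall>u\<^sub>1\<in>U. \<forall>v\<in>V. \<forall>w\<in>V.
        (\<psi> (u, v), \<psi> (u\<^sub>1, w)) \<in> composable G \<longleftrightarrow> u\<^sub>1 = \<sigma> (u, v)) \<and>
     open (product_domain G U V \<psi> \<sigma>) \<and>
     U \<times> {0} \<times> {0} \<subseteq> product_domain G U V \<psi> \<sigma> \<and>
     (\<exists>(p :: 'u \<Rightarrow> 'v \<Rightarrow> 'v \<Rightarrow> 'v) (B :: 'u \<Rightarrow> 'v \<Rightarrow> 'v \<Rightarrow> 'v).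
        \<comment> \<open>(i)\<close>
        (\<forall>(u, v, w)\<in>product_domain G U V \<psi> \<sigma>.
           p u v w \<in> V \<and> prod_of G (\<psi> (u, v)) (\<psi> (\<sigma> (u, v), w)) = \<psi> (u, p u v w)) \<and>
        smooth_on (product_domain G U V \<psi> \<sigma>) (\<lambda>(u, v, w). p u v w) \<and>
        (\<forall>u\<in>U. bilinear (B u)) \<and>
        (\<exists>O\<^sub>3 :: 'u \<Rightarrow> 'v \<Rightarrow> 'v \<Rightarrow> 'v.
           (\<forall>(u, v, w)\<in>product_domain G U V \<psi> \<sigma>. p u v w = v + w + B u v w + O\<^sub>3 u v w) \<and>
           (\<forall>u\<^sub>0\<in>U. (\<lambda>(u, v, w). norm (O\<^sub>3 u v w))
              \<in> O[nhds (u\<^sub>0, 0, 0)](\<lambda>(u, v, w). norm (v, w) ^ 3))) \<and>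
        \<comment> \<open>(ii)\<close>
        (\<exists>(w :: 'u \<Rightarrow> 'v \<Rightarrow> 'v) (O\<^sub>3 :: 'u \<Rightarrow> 'v \<Rightarrow> 'v).
           (\<forall>(u, v)\<in>inverse_domain G U V \<psi>.
              w u v \<in> V \<and> inv_of G (\<psi> (u, v)) = \<psi> (\<sigma> (u, v), w u v) \<and>
              (u, v, w u v) \<in> product_domain G U V \<psi> \<sigma> \<and> p u v (w u v) = 0 \<and>
              w u v = - v + B u v v + O\<^sub>3 u v) \<and>
           (\<forall>u\<^sub>0\<in>U. (\<lambda>(u, v). norm (O\<^sub>3 u v))
              \<in> O[inf (nhds (u\<^sub>0, 0)) (principal (inverse_domain G U V \<psi>))](\<lambda>(u, v). norm v ^ 3))))"
proof -
  interpret adapted_lie_groupoid G X A x\<^sub>0 U V \<psi> \<phi> \<sigma>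
    using assms by unfold_locales
  let ?p = "\<lambda>u v w. loc_prod (u, v, w)"
  \<comment> \<open>Both remainders are defined as differences, so the expansions hold identically
    and their content lies in the order estimates.\<close>
  let ?R = "\<lambda>u v w. ?p u v w - v - w - mixed u v w"
  let ?Q = "\<lambda>u v. loc_inv u v + v - mixed u v v"
  have composable_iff: "\<forall>u\<in>U. \<forall>u\<^sub>1\<in>U. \<forall>v\<in>V. \<forall>w\<in>V.
      (\<psi> (u, v), \<psi> (u\<^sub>1, w)) \<in> composable G \<longleftrightarrow> u\<^sub>1 = \<sigma> (u, v)"
    by (intro ballI composable_psi_iff)
  have units: "U \<times> {0} \<times> {0} \<subseteq> pdom"
    using zero_in_pdom by auto
  have prod: "\<forall>(u, v, w)\<in>pdom.
      ?p u v w \<in> V \<and> prod_of G (\<psi> (u, v)) (\<psi> (\<sigma> (u, v), w)) = \<psi> (u, ?p u v w)"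
  proof clarify
    fix u v w assume "(u, v, w) \<in> pdom"
    from mult_eq[OF this] show "?p u v w \<in> V \<and>
        prod_of G (\<psi> (u, v)) (\<psi> (\<sigma> (u, v), w)) = \<psi> (u, ?p u v w)"
      by (simp add: mult_def)
  qed
  have smooth: "smooth_on pdom (\<lambda>(u, v, w). ?p u v w)"
    using smooth_loc_prod by (simp add: case_prod_unfold)
  have bilin: "\<forall>u\<in>U. bilinear (mixed u)"
    using bilinear_mixed[OF zero_in_pdom] by blast
  have expand: "\<forall>(u, v, w)\<in>pdom. ?p u v w = v + w + mixed u v w + ?R u v w"
    by (simp add: case_prod_unfold)
  have inverse: "\<forall>(u, v)\<in>inverse_domain G U V \<psi>. loc_inv u v \<in> V \<and>
      inv_of G (\<psi> (u, v)) = \<psi> (\<sigma> (u, v), loc_inv u v) \<and> (u, v, loc_inv u v) \<in> pdom \<and>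
      ?p u v (loc_inv u v) = 0 \<and> loc_inv u v = - v + mixed u v v + ?Q u v"
  proof clarify
    fix u v assume "(u, v) \<in> inverse_domain G U V \<psi>"
    from loc_inv_works[OF this] show "loc_inv u v \<in> V \<and>
        inv_of G (\<psi> (u, v)) = \<psi> (\<sigma> (u, v), loc_inv u v) \<and> (u, v, loc_inv u v) \<in> pdom \<and>
        ?p u v (loc_inv u v) = 0 \<and> loc_inv u v = - v + mixed u v v + ?Q u v"
      by simp
  qed
  have bigo: "\<forall>u\<^sub>0\<in>U. (\<lambda>(u, v, w). norm (?R u v w)) \<in> O[nhds (u\<^sub>0, 0, 0)](\<lambda>(u, v, w). norm (v, w) ^ 3)"
    "\<forall>u\<^sub>0\<in>U. (\<lambda>(u, v). norm (?Q u v))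
      \<in> O[inf (nhds (u\<^sub>0, 0)) (principal (inverse_domain G U V \<psi>))](\<lambda>(u, v). norm v ^ 3)"
    using product_remainder_bigo inverse_remainder_bigo by blast+
  show ?thesis
    by (rule conjI[OF composable_iff conjI[OF open_pdom conjI[OF units]]],
        rule exI[of _ ?p], rule exI[of _ mixed],
        rule conjI[OF prod conjI[OF smooth conjI[OF bilin conjI]]],
        rule exI[of _ ?R], rule conjI[OF expand bigo(1)],
        rule exI[of _ loc_inv], rule exI[of _ ?Q], rule conjI[OF inverse bigo(2)])
qed

end
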